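(* Let $\mathcal{C}$ be a quasiminimal class. Let $(M,H)$ be an $H$-structure (respectively, a beautiful pair) associated to $\mathcal{C}$, and let $B\subseteq M$ be closed, $H$-independent and countable. Then there are at most countably many types over $B$ realized in $(M,H)$.
   Context: **Quasiminimal classes.** Let $\mathcal{L}$ be a countable language. $\operatorname{tp}$ denotes the quantifier-free $\mathcal{L}$-type of a (possibly infinite, enumerated) tuple; in the structures below it is identified with the $\mathcal{L}_{\omega_1\omega}$-type. An $\mathcal{L}$-structure $M$ equipped with a pregeometry $\operatorname{cl}$ is a *quasiminimal pregeometry structure* if: (QM1) if $\operatorname{tp}(a,\vec b)=\operatorname{tp}(a',\vec b')$ then $a\in\operatorname{cl}(\vec b)$ iff $a'\in\operatorname{cl}(\vec b')$; (QM2) $M$ is infinite-dimensional with respect to $\operatorname{cl}$; (QM3) $\operatorname{cl}(A)$ is countable for every finite $A\subseteq M$; (QM4) if $A,A'\subseteq M$ are countable closed subsets enumerated so that $\operatorname{tp}(A)=\operatorname{tp}(A')$, $a\in M\setminus A$ and $a'\in M\setminus A'$, then $\operatorname{tp}(A,a)=\operatorname{tp}(A',a')$; (QM5) if $A,A'\subseteq M$ are countable closed subsets or empty, enumerated so that $\operatorname{tp}(A)=\operatorname{tp}(A')$, $\vec b,\vec b'$ are finite tuples with $\operatorname{tp}(A,\vec b)=\operatorname{tp}(A',\vec b')$ and $a\in\operatorname{cl}(A,\vec b)$, then there is $a'\in M$ with $\operatorname{tp}(A,\vec b,a)=\operatorname{tp}(A',\vec b',a')$. It is a *weakly quasiminimal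 pregeometry structure* if all axioms except possibly QM2 hold. An embedding $\theta:M_1\to M_2$ of such structures is *closed* if $\theta(\operatorname{cl}_{M_1}(A))=\operatorname{cl}_{M_2}(\theta(A))$ for all $A\subseteq M_1$; $M_1\preceq M_2$ means that the inclusion is a closed embedding. A *quasiminimal class* $\mathcal{C}$ is the smallest class of $\mathcal{L}$-structures containing a given quasiminimal pregeometry structure and closed under isomorphism, closed substructures, and unions of chains of closed embeddings; each member is a weakly quasiminimal pregeometry structure with its pregeometry $\operatorname{cl}$. $\dim(\vec a/B)$ is the dimension of $\vec a$ in the localized pregeometry $\operatorname{cl}_B(X)=\operatorname{cl}(X\cup B)$. **Expansions.** Let $H$ be a new unary predicate (written $P$ for beautiful pairs), $\mathcal{L}_H=\mathcal{L}\cup\{H\}$, $M\in\mathcal{C}$. $(M,H)$ is *dense-codense* if for all $b_1,\dots,b_n\in M$: (density) some $a\in H(M)$ realizes the unique generic type over $\operatorname{cl}(b_1,\dots,b_n)$, i.e. $a\notin\operatorname{cl}(b_1,\dots,b_n)$; (codensity) there is $a\in M$ with $a\notin\operatorname{cl}(\{b_1,\dots,b_n\}\cup H(M))$. A dense-codense $(M,H)$ is an *$H$-structure* if any distinct elements of $H(M)$ are $\operatorname{cl}$-independent; it is a *beautiful pair* if $H(M)\in\mathcal{C}$ and $H(M)\preceq M$. Types over $B$ are types in the expanded language: $\operatorname{tp}_H(\vec a/B)$ denotes the $(\mathcal{L}_H)_{\omega_1\omega}$-type over $B$ in $(M,H)$ of a finite tuple $\vec a$ from $M$. $B$ is *closed*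 if $\operatorname{cl}(B)=B$. With $H(B)=B\cap H(M)$, the set $B$ is *$H$-independent* if $\dim(\vec b/H(B))=\dim(\vec b/H(M))$ for all finite tuples $\vec b$ in $B$ (for beautiful pairs, the same with $P$ in place of $H$). *)

theory Defs
  imports Main "HOL-Library.Countable_Set"
begin

record ('f, 'r) lang =
  Funs :: "'f set"
  Rels :: "'r set"
  far :: "'f \<Rightarrow> nat"
  rar :: "'r \<Rightarrow> nat"

definition countable_lang :: "('f, 'r) lang \<Rightarrow> bool" where
  "countable_lang L \<longleftrightarrow> countable (Funs L) \<and> countable (Rels L)"

text \<open>
  Only the values of the interpretations at symbols of the language and at tuples from the universe
  of the right length are meaningful. The universe may be empty, since the closure of the empty set
  is a structure of a quasiminimal class.
\<close>

record ('f, 'r, 'a) struc =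
  univ :: "'a set"
  fun_of :: "'f \<Rightarrow> 'a list \<Rightarrow> 'a"
  rel_of :: "'r \<Rightarrow> 'a list \<Rightarrow> bool"

definition is_struc :: "('f, 'r) lang \<Rightarrow> ('f, 'r, 'a, 'z) struc_scheme \<Rightarrow> bool" where
  "is_struc L M \<longleftrightarrow>
     (\<forall>f\<in>Funs L. \<forall>xs. set xs \<subseteq> univ M \<and> length xs = far L f \<longrightarrow> fun_of M f xs \<in> univ M)"

definition embedding ::
  "('f, 'r) lang \<Rightarrow> ('a \<Rightarrow> 'b) \<Rightarrow> ('f, 'r, 'a, 'z) struc_scheme
     \<Rightarrow> ('f, 'r, 'b, 'y) struc_scheme \<Rightarrow> bool" where
  "embedding L \<theta> M N \<longleftrightarrow>
     inj_on \<theta> (univ M) \<and> \<theta> ` univ M \<subseteq> univ N \<and>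
     (\<forall>f\<in>Funs L. \<forall>xs. set xs \<subseteq> univ M \<and> length xs = far L f \<longrightarrow>
        \<theta> (fun_of M f xs) = fun_of N f (map \<theta> xs)) \<and>
     (\<forall>r\<in>Rels L. \<forall>xs. set xs \<subseteq> univ M \<and> length xs = rar L r \<longrightarrow>
        rel_of M r xs = rel_of N r (map \<theta> xs))"

datatype ('f, tvars: 'v) tm = Var 'v | App 'f "('f, 'v) tm list"

text \<open>\<open>CAnd\<close> is countable conjunction; disjunctions and universal quantifiers are
  obtained by negation.\<close>

datatype ('f, 'r, 'v) fm =
    Eq "('f, 'v) tm" "('f, 'v) tm"
  | Rel 'r "('f, 'v) tm list"
  | Neg "('f, 'r, 'v) fm"
  | And "('f, 'r, 'v) fm" "('f, 'r, 'v) fm"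
  | CAnd "nat \<Rightarrow> ('f, 'r, 'v) fm"
  | Ex 'v "('f, 'r, 'v) fm"

fun wf_tm :: "('f, 'r) lang \<Rightarrow> ('f, 'v) tm \<Rightarrow> bool" where
  "wf_tm L (Var x) = True"
| "wf_tm L (App f ts) = (f \<in> Funs L \<and> length ts = far L f \<and> (\<forall>t\<in>set ts. wf_tm L t))"

primrec wf_fm :: "('f, 'r) lang \<Rightarrow> ('f, 'r, 'v) fm \<Rightarrow> bool" where
  "wf_fm L (Eq s t) = (wf_tm L s \<and> wf_tm L t)"
| "wf_fm L (Rel r ts) = (r \<in> Rels L \<and> length ts = rar L r \<and> (\<forall>t\<in>set ts. wf_tm L t))"
| "wf_fm L (Neg \<phi>) = wf_fm L \<phi>"
| "wf_fm L (And \<phi> \<psi>) = (wf_fm L \<phi> \<and> wf_fm L \<psi>)"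
| "wf_fm L (CAnd \<Phi>) = (\<forall>n. wf_fm L (\<Phi> n))"
| "wf_fm L (Ex x \<phi>) = wf_fm L \<phi>"

primrec fvars :: "('f, 'r, 'v) fm \<Rightarrow> 'v set" where
  "fvars (Eq s t) = tvars s \<union> tvars t"
| "fvars (Rel r ts) = (\<Union>t\<in>set ts. tvars t)"
| "fvars (Neg \<phi>) = fvars \<phi>"
| "fvars (And \<phi> \<psi>) = fvars \<phi> \<union> fvars \<psi>"
| "fvars (CAnd \<Phi>) = (\<Union>n. fvars (\<Phi> n))"
| "fvars (Ex x \<phi>) = fvars \<phi> - {x}"

primrec qfree :: "('f, 'r, 'v) fm \<Rightarrow> bool" where
  "qfree (Eq s t) = True"
| "qfree (Rel r ts) = True"
| "qfree (Neg \<phi>) = qfree \<phi>"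
| "qfree (And \<phi> \<psi>) = (qfree \<phi> \<and> qfree \<psi>)"
| "qfree (CAnd \<Phi>) = False"
| "qfree (Ex x \<phi>) = False"

fun val :: "('f, 'r, 'a, 'z) struc_scheme \<Rightarrow> ('v \<Rightarrow> 'a) \<Rightarrow> ('f, 'v) tm \<Rightarrow> 'a" where
  "val M e (Var x) = e x"
| "val M e (App f ts) = fun_of M f (map (val M e) ts)"

primrec sat :: "('f, 'r, 'a, 'z) struc_scheme \<Rightarrow> ('f, 'r, 'v) fm \<Rightarrow> ('v \<Rightarrow> 'a) \<Rightarrow> bool" where
  "sat M (Eq s t) e = (val M e s = val M e t)"
| "sat M (Rel r ts) e = rel_of M r (map (val M e) ts)"
| "sat M (Neg \<phi>) e = (\<not> sat M \<phi> e)"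
| "sat M (And \<phi> \<psi>) e = (sat M \<phi> e \<and> sat M \<psi> e)"
| "sat M (CAnd \<Phi>) e = (\<forall>n. sat M (\<Phi> n) e)"
| "sat M (Ex x \<phi>) e = (\<exists>a\<in>univ M. sat M \<phi> (e(x := a)))"

text \<open>The quantifier-free type of the tuple \<open>(e i)\<close>, \<open>i \<in> I\<close>, with \<open>i\<close> itself as the variable for
  the entry \<open>e i\<close>. Here \<open>qfree\<close> admits finitary Boolean combinations only.\<close>

definition qftp ::
  "('f, 'r) lang \<Rightarrow> ('f, 'r, 'a, 'z) struc_scheme \<Rightarrow> 'v set \<Rightarrow> ('v \<Rightarrow> 'a) \<Rightarrow> ('f, 'r, 'v) fm set" where
  "qftp L M I e = {\<phi>. wf_fm L \<phi> \<and> qfree \<phi> \<and> fvars \<phi> \<subseteq> I \<and> sat M \<phi> e}"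

definition qftp_list ::
  "('f, 'r) lang \<Rightarrow> ('f, 'r, 'a, 'z) struc_scheme \<Rightarrow> 'a list \<Rightarrow> ('f, 'r, nat) fm set" where
  "qftp_list L M bs = qftp L M {..<length bs} (\<lambda>i. bs ! i)"

text \<open>The quantifier-free type of \<open>(A, bs)\<close>, where the set \<open>A = e ` I\<close> is enumerated by \<open>e\<close> on the
  index set \<open>I\<close> and \<open>bs\<close> is a finite tuple.\<close>

definition qftp_app ::
  "('f, 'r) lang \<Rightarrow> ('f, 'r, 'a, 'z) struc_scheme \<Rightarrow> nat set \<Rightarrow> (nat \<Rightarrow> 'a) \<Rightarrow> 'a list
     \<Rightarrow> ('f, 'r, nat + nat) fm set" where
  "qftp_app L M I e bs =
     qftp L M (I <+> {..<length bs}) (case_sum e (\<lambda>i. bs ! i))"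

locale pregeometry =
  fixes S :: "'a set" and cl :: "'a set \<Rightarrow> 'a set"
  assumes cl_subset: "A \<subseteq> S \<Longrightarrow> cl A \<subseteq> S"
    and cl_extensive: "A \<subseteq> S \<Longrightarrow> A \<subseteq> cl A"
    and cl_mono: "A \<subseteq> A' \<Longrightarrow> A' \<subseteq> S \<Longrightarrow> cl A \<subseteq> cl A'"
    and cl_idem: "A \<subseteq> S \<Longrightarrow> cl (cl A) = cl A"
    and cl_finitary: "A \<subseteq> S \<Longrightarrow> a \<in> cl A \<Longrightarrow> \<exists>F. finite F \<and> F \<subseteq> A \<and> a \<in> cl F"
    and cl_exchange: "A \<subseteq> S \<Longrightarrow> a \<in> S \<Longrightarrow> b \<in> S \<Longrightarrow> a \<in> cl (insert b A) \<Longrightarrow> a \<notin> cl A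
      \<Longrightarrow> b \<in> cl (insert a A)"

definition cl_indep :: "('a set \<Rightarrow> 'a set) \<Rightarrow> 'a set \<Rightarrow> bool" where
  "cl_indep cl X \<longleftrightarrow> (\<forall>x\<in>X. x \<notin> cl (X - {x}))"

definition cl_basis :: "('a set \<Rightarrow> 'a set) \<Rightarrow> 'a set \<Rightarrow> 'a set \<Rightarrow> bool" where
  "cl_basis cl X Y \<longleftrightarrow> Y \<subseteq> X \<and> cl_indep cl Y \<and> X \<subseteq> cl Y"

text \<open>By exchange the size of a basis does not depend on the choice. The number \<open>cl_dim cl X\<close> is
  meaningful for finite-dimensional \<open>X\<close> only (\<open>card\<close> is 0 on infinite sets).\<close>

definition cl_dim :: "('a set \<Rightarrow> 'a set) \<Rightarrow> 'a set \<Rightarrow> nat" where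
  "cl_dim cl X = card (SOME Y. cl_basis cl X Y)"

definition infinite_dimensional :: "('a set \<Rightarrow> 'a set) \<Rightarrow> 'a set \<Rightarrow> bool" where
  "infinite_dimensional cl X \<longleftrightarrow> (\<exists>Y. cl_basis cl X Y \<and> infinite Y)"

definition localize :: "('a set \<Rightarrow> 'a set) \<Rightarrow> 'a set \<Rightarrow> 'a set \<Rightarrow> 'a set" where
  "localize cl B X = cl (X \<union> B)"

text \<open>Only the values of \<open>Cl M\<close> at subsets of \<open>univ M\<close> are meaningful.\<close>

record ('f, 'r, 'a) pgstruc = "('f, 'r, 'a) struc" +
  Cl :: "'a set \<Rightarrow> 'a set"

text \<open>In QM4 and QM5 the sets \<open>A = e ` I\<close> and \<open>A' = e' ` I\<close> are enumerated on a common index set \<open>I\<close> of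
  natural numbers; this covers all countable sets, including the empty one.\<close>

locale weakly_quasiminimal = pregeometry "univ M" "Cl M"
  for L :: "('f, 'r) lang" and M :: "('f, 'r, 'a) pgstruc" +
  assumes is_struc: "is_struc L M"
    and QM1: "\<lbrakk>set (a # bs) \<subseteq> univ M; set (a' # bs') \<subseteq> univ M; length bs = length bs';
        qftp_list L M (a # bs) = qftp_list L M (a' # bs')\<rbrakk>
      \<Longrightarrow> a \<in> Cl M (set bs) \<longleftrightarrow> a' \<in> Cl M (set bs')"
    and QM3: "\<lbrakk>A \<subseteq> univ M; finite A\<rbrakk> \<Longrightarrow> countable (Cl M A)"
    and QM4: "\<lbrakk>A \<subseteq> univ M; A' \<subseteq> univ M; Cl M A = A; Cl M A' = A'; e ` I = A; e' ` I = A';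
        qftp L M I e = qftp L M I e';
        a \<in> univ M - A; a' \<in> univ M - A'\<rbrakk>
      \<Longrightarrow> qftp_app L M I e [a] = qftp_app L M I e' [a']"
    and QM5: "\<lbrakk>A \<subseteq> univ M; A' \<subseteq> univ M; Cl M A = A \<or> A = {}; Cl M A' = A' \<or> A' = {};
        e ` I = A; e' ` I = A'; qftp L M I e = qftp L M I e';
        set bs \<subseteq> univ M; set bs' \<subseteq> univ M; length bs = length bs';
        qftp_app L M I e bs = qftp_app L M I e' bs';
        a \<in> Cl M (A \<union> set bs)\<rbrakk>
      \<Longrightarrow> \<exists>a'\<in>univ M. qftp_app L M I e (bs @ [a]) = qftp_app L M I e' (bs' @ [a'])"

locale quasiminimal = weakly_quasiminimal +
  assumes QM2: "infinite_dimensional (Cl M) (univ M)"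

definition closed_embedding ::
  "('f, 'r) lang \<Rightarrow> ('a \<Rightarrow> 'b) \<Rightarrow> ('f, 'r, 'a) pgstruc \<Rightarrow> ('f, 'r, 'b) pgstruc \<Rightarrow> bool" where
  "closed_embedding L \<theta> M N \<longleftrightarrow>
     embedding L \<theta> M N \<and> (\<forall>A. A \<subseteq> univ M \<longrightarrow> \<theta> ` Cl M A = Cl N (\<theta> ` A))"

definition closed_sub ::
  "('f, 'r) lang \<Rightarrow> ('f, 'r, 'a) pgstruc \<Rightarrow> ('f, 'r, 'a) pgstruc \<Rightarrow> bool" where
  "closed_sub L M N \<longleftrightarrow> closed_embedding L id M N"

definition isomorphism ::
  "('f, 'r) lang \<Rightarrow> ('a \<Rightarrow> 'b) \<Rightarrow> ('f, 'r, 'a) pgstruc \<Rightarrow> ('f, 'r, 'b) pgstruc \<Rightarrow> bool" where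
  "isomorphism L \<theta> M N \<longleftrightarrow> closed_embedding L \<theta> M N \<and> \<theta> ` univ M = univ N"

text \<open>The last clause forces \<open>Cl N\<close> to be the finitary operator extending those of the members
  of \<open>K\<close>.\<close>

definition chain_union ::
  "('f, 'r) lang \<Rightarrow> ('f, 'r, 'a) pgstruc set \<Rightarrow> ('f, 'r, 'a) pgstruc \<Rightarrow> bool" where
  "chain_union L K N \<longleftrightarrow>
     K \<noteq> {} \<and> (\<forall>M\<in>K. \<forall>M'\<in>K. closed_sub L M M' \<or> closed_sub L M' M) \<and>
     univ N = (\<Union>M\<in>K. univ M) \<and> (\<forall>M\<in>K. embedding L id M N) \<and>
     (\<forall>A. A \<subseteq> univ N \<longrightarrow>
        Cl N A = \<Union>{Cl M F |M F. M \<in> K \<and> finite F \<and> F \<subseteq> A \<and> F \<subseteq> univ M})"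

text \<open>
  The class generated by \<open>M0\<close>, restricted to structures whose elements are taken from the type \<open>'a\<close>.
  As \<open>'a\<close> is arbitrary this loses nothing: a member of the class is obtained from \<open>M0\<close>
  through a set of structures, all of which have isomorphic copies inside a large enough type.
  Isomorphisms preserve \<open>Cl\<close>, and a closed substructure carries the restriction of \<open>Cl\<close>.
\<close>

inductive_set generated_class ::
  "('f, 'r) lang \<Rightarrow> ('f, 'r, 'a) pgstruc \<Rightarrow> ('f, 'r, 'a) pgstruc set"
  for L :: "('f, 'r) lang" and M0 :: "('f, 'r, 'a) pgstruc" where
  base: "M0 \<in> generated_class L M0"
| iso: "M \<in> generated_class L M0 \<Longrightarrow> isomorphism L \<theta> M N \<Longrightarrow> N \<in> generated_class L M0"
| closed_substruc: "M \<in> generated_class L M0 \<Longrightarrow> X \<subseteq> univ M \<Longrightarrow> Cl M X = X \<Longrightarrow>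
    is_struc L (M\<lparr>univ := X\<rparr>) \<Longrightarrow> M\<lparr>univ := X\<rparr> \<in> generated_class L M0"
| union: "(\<And>M. M \<in> K \<Longrightarrow> M \<in> generated_class L M0) \<Longrightarrow> chain_union L K N \<Longrightarrow>
    N \<in> generated_class L M0"

definition quasiminimal_class :: "('f, 'r) lang \<Rightarrow> ('f, 'r, 'a) pgstruc set \<Rightarrow> bool" where
  "quasiminimal_class L \<C> \<longleftrightarrow>
     countable_lang L \<and> (\<exists>M0. quasiminimal L M0 \<and> \<C> = generated_class L M0)"

definition dense_codense ::
  "('f, 'r, 'a) pgstruc set \<Rightarrow> ('f, 'r, 'a) pgstruc \<Rightarrow> 'a set \<Rightarrow> bool" where
  "dense_codense \<C> M H \<longleftrightarrow>
     M \<in> \<C> \<and> H \<subseteq> univ M \<and>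
     (\<forall>bs. set bs \<subseteq> univ M \<longrightarrow>
        (\<exists>a\<in>H. a \<notin> Cl M (set bs)) \<and> (\<exists>a\<in>univ M. a \<notin> Cl M (set bs \<union> H)))"

definition H_structure ::
  "('f, 'r, 'a) pgstruc set \<Rightarrow> ('f, 'r, 'a) pgstruc \<Rightarrow> 'a set \<Rightarrow> bool" where
  "H_structure \<C> M H \<longleftrightarrow>
     dense_codense \<C> M H \<and> (\<forall>F. finite F \<and> F \<subseteq> H \<longrightarrow> cl_indep (Cl M) F)"

definition beautiful_pair ::
  "('f, 'r) lang \<Rightarrow> ('f, 'r, 'a) pgstruc set \<Rightarrow> ('f, 'r, 'a) pgstruc \<Rightarrow> 'a set \<Rightarrow> bool" where
  "beautiful_pair L \<C> M H \<longleftrightarrow>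
     dense_codense \<C> M H \<and> (\<exists>N\<in>\<C>. univ N = H \<and> closed_sub L N M)"

definition H_independent :: "('f, 'r, 'a) pgstruc \<Rightarrow> 'a set \<Rightarrow> 'a set \<Rightarrow> bool" where
  "H_independent M H B \<longleftrightarrow>
     (\<forall>bs. set bs \<subseteq> B \<longrightarrow>
        cl_dim (localize (Cl M) (B \<inter> H)) (set bs) = cl_dim (localize (Cl M) H) (set bs))"

text \<open>The new unary predicate symbol is \<open>None\<close>.\<close>

definition expand_lang :: "('f, 'r) lang \<Rightarrow> ('f, 'r option) lang" where
  "expand_lang L =
     \<lparr>Funs = Funs L, Rels = insert None (Some ` Rels L), far = far L, rar = case_option 1 (rar L)\<rparr>"

definition expand :: "('f, 'r, 'a) pgstruc \<Rightarrow> 'a set \<Rightarrow> ('f, 'r option, 'a) struc" where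
  "expand M H =
     \<lparr>univ = univ M, fun_of = fun_of M,
      rel_of = (\<lambda>r xs. case r of None \<Rightarrow> (\<exists>x\<in>H. xs = [x]) | Some r' \<Rightarrow> rel_of M r' xs)\<rparr>"

text \<open>
  The infinitary type of the tuple \<open>as\<close> over \<open>B\<close> in the expanded language. A formula with parameters
  is a pair \<open>(\<phi>, bs)\<close>, the parameters \<open>bs\<close> from \<open>B\<close> being substituted for the variables from
  \<open>length as\<close> on. As usual for infinitary logic \<open>\<phi>\<close> has finitely many free variables; this is
  inherited by its subformulas, as a quantifier binds only one variable.
\<close>

definition tp_H ::
  "('f, 'r) lang \<Rightarrow> ('f, 'r, 'a) pgstruc \<Rightarrow> 'a set \<Rightarrow> 'a list \<Rightarrow> 'a set
     \<Rightarrow> (('f, 'r option, nat) fm \<times> 'a list) set" where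
  "tp_H L M H as B =
     {(\<phi>, bs). set bs \<subseteq> B \<and> wf_fm (expand_lang L) \<phi> \<and>
        fvars \<phi> \<subseteq> {..<length as + length bs} \<and> sat (expand M H) \<phi> (\<lambda>i. (as @ bs) ! i)}"

end

theory Submission
  imports Defs
begin

text \<open>
  The type of a tuple over \<open>B\<close> is controlled by two numbers. Given a finite tuple \<open>as\<close>, choose a finite
  \<open>Q\<close> independent over \<open>B \<union> H\<close> and a finite \<open>P \<subseteq> H\<close> independent over \<open>B\<close> such that \<open>as\<close> lies in
  \<open>cl (B \<union> P \<union> Q)\<close>. If \<open>P'\<close>, \<open>Q'\<close> is another such pair with \<open>card P' = card P\<close> and
  \<open>card Q' = card Q\<close>, then \<open>cl (B \<union> P \<union> Q)\<close> and \<open>cl (B \<union> P' \<union> Q')\<close> are isomorphic over \<open>B\<close>: the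
  generic type over a countable closed set is unique, so the points of \<open>P\<close> and \<open>Q\<close> are matched one
  after the other, passing to the closure each time (\<open>generic_extension\<close>). The isomorphism also
  respects \<open>H\<close>, because \<open>H\<close>-independence of \<open>B\<close> forces every element of \<open>H\<close> in \<open>cl (B \<union> P \<union> Q)\<close> to
  lie in \<open>cl (P \<union> (B \<inter> H))\<close> (\<open>mem_H_cl_trace\<close>), a set that the isomorphism moves to its counterpart;
  in an \<open>H\<close>-structure the elements of \<open>H\<close> in it are just those of \<open>P \<union> (B \<inter> H)\<close>, in a beautiful pair
  all of it lies in \<open>H\<close>.

  These isomorphisms form a back-and-forth system (\<open>back_forth_extend\<close>): to absorb a new element,
  enlarge \<open>P\<close> or \<open>Q\<close> on one side; Steinitz exchange then supplies a new point for the other side, since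
  one of the two independent sets has become strictly larger than its partner. So they preserve all
  infinitary formulas of the expanded language (\<open>back_forth_sat\<close>), and every type over \<open>B\<close> that is
  realized by some tuple in some \<open>cl (B \<union> P \<union> Q)\<close> with \<open>card P = m\<close>, \<open>card Q = n\<close> is realized in one fixed
  such closure. That closure is countable, hence gives only countably many types, and there are
  countably many pairs \<open>(m, n)\<close>.

  The axioms are given for the structure \<open>M0\<close> that generates the class, and have to be carried to
  its members. A member may be much larger than \<open>M0\<close>, but the argument above only looks at countable
  closed sets, and these reappear in \<open>M0\<close>. By induction along the generation of the
  class, the closure of a finite set in a member is isomorphic to a closed subset of \<open>M0\<close>
  (\<open>generated_class_locally_embeddable\<close>). A countable closed set is the union of an increasing
  sequence of such closures, and the embeddings of these can be made to cohere by correcting each one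
  with a partial isomorphism of \<open>M0\<close> (\<open>countable_closed_embeds\<close>). The extension property of \<open>M0\<close>
  is then pulled back to the member (\<open>generated_class_generic_homogeneous\<close>).

  Partial isomorphisms are treated as sets of pairs. That makes inverses, composites and unions of
  chains immediate, and lets one relation stand for all enumerations of its domain.
\<close>

section \<open>Independence over a set in a pregeometry\<close>

abbreviation indep_over :: "('a set \<Rightarrow> 'a set) \<Rightarrow> 'a set \<Rightarrow> 'a set \<Rightarrow> bool" where
  "indep_over cl D P \<equiv> cl_indep (localize cl D) P"

lemma indep_over_iff: "indep_over cl D P \<longleftrightarrow> (\<forall>x\<in>P. x \<notin> cl (P - {x} \<union> D))"
  by (simp add: cl_indep_def localize_def)

text \<open>Localizing at \<open>D\<close> turns independence over \<open>D\<close> into plain independence, so that the bases and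
  dimensions in the definition of \<open>H\<close>-independence speak about this notion.\<close>

context pregeometry
begin

lemma cl_least: "A \<subseteq> cl X \<Longrightarrow> X \<subseteq> S \<Longrightarrow> cl A \<subseteq> cl X"
  by (metis cl_idem cl_mono cl_subset)

lemma in_cl_mono: "x \<in> cl A \<Longrightarrow> A \<subseteq> A' \<Longrightarrow> A' \<subseteq> S \<Longrightarrow> x \<in> cl A'"
  using cl_mono by blast

lemma cl_insert_cl: "A \<subseteq> S \<Longrightarrow> x \<in> S \<Longrightarrow> cl (insert x (cl A)) = cl (insert x A)"
proof
  assume A: "A \<subseteq> S" "x \<in> S"
  show "cl (insert x (cl A)) \<subseteq> cl (insert x A)"
    using A cl_extensive[of "insert x A"] cl_mono[of A "insert x A"] by (intro cl_least) auto
  show "cl (insert x A) \<subseteq> cl (insert x (cl A))"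
    using A cl_extensive[of A] cl_subset[of A] by (intro cl_mono) auto
qed

lemma countable_cl:
  assumes "\<And>F. finite F \<Longrightarrow> F \<subseteq> S \<Longrightarrow> countable (cl F)" and "A \<subseteq> S" and "countable A"
  shows "countable (cl A)"
proof -
  have "cl A \<subseteq> (\<Union>F\<in>{F. finite F \<and> F \<subseteq> A}. cl F)"
    using cl_finitary[OF assms(2)] by (intro subsetI) (metis (mono_tags) UN_I mem_Collect_eq)
  moreover have "countable (\<Union>F\<in>{F. finite F \<and> F \<subseteq> A}. cl F)"
  proof (rule countable_UN)
    show "countable {F. finite F \<and> F \<subseteq> A}"
      by (rule countable_Collect_finite_subset[OF assms(3)])
    show "countable (cl F)" if "F \<in> {F. finite F \<and> F \<subseteq> A}" for F
      using that assms(1)[of F] assms(2) by (metis mem_Collect_eq subset_trans)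
  qed
  ultimately show ?thesis by (rule countable_subset)
qed

lemma indep_over_subset:
  assumes "indep_over cl D P" "P' \<subseteq> P" "P \<subseteq> S" "D \<subseteq> S"
  shows "indep_over cl D P'"
  unfolding indep_over_iff
proof
  fix x assume "x \<in> P'"
  then have "x \<notin> cl (P - {x} \<union> D)" using assms by (auto simp: indep_over_iff)
  moreover have "P' - {x} \<union> D \<subseteq> P - {x} \<union> D" using assms by auto
  ultimately show "x \<notin> cl (P' - {x} \<union> D)"
    using in_cl_mono assms by (meson Diff_subset Un_least subset_trans)
qed

lemma indep_over_insert:
  assumes "indep_over cl D P" "x \<notin> cl (P \<union> D)" "P \<subseteq> S" "D \<subseteq> S" "x \<in> S"
  shows "indep_over cl D (insert x P)"
  unfolding indep_over_iff
proof
  have xP: "x \<notin> P" using assms(2-4) cl_extensive[of "P \<union> D"] by blast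
  fix y assume y: "y \<in> insert x P"
  show "y \<notin> cl (insert x P - {y} \<union> D)"
  proof (cases "y = x")
    case True
    then show ?thesis using xP assms(2) by (simp add: insert_Diff_if)
  next
    case False
    then have yP: "y \<in> P" using y by simp
    show ?thesis
    proof
      assume "y \<in> cl (insert x P - {y} \<union> D)"
      then have "y \<in> cl (insert x (P - {y} \<union> D))" using False by (simp add: insert_Diff_if)
      moreover have "y \<notin> cl (P - {y} \<union> D)" using assms(1) yP by (simp add: indep_over_iff)
      ultimately have "x \<in> cl (insert y (P - {y} \<union> D))"
        using cl_exchange[of "P - {y} \<union> D" y x] assms yP by blast
      moreover have "insert y (P - {y} \<union> D) = P \<union> D" using yP by auto
      ultimately show False using assms(2) by simp
    qed
  qed
qed

text \<open>If some \<open>p \<in> P\<close> is outside \<open>cl (Q \<union> D)\<close>, exchange makes the last point \<open>q\<close> of the spanning set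
  redundant in the presence of \<open>p\<close>. Moving \<open>p\<close> into \<open>D\<close> then shortens both sets by one, which is why
  the induction generalizes over \<open>D\<close>.\<close>

lemma steinitz_card_le:
  assumes "finite Q"
  shows "\<lbrakk>indep_over cl D P; P \<subseteq> cl (Q \<union> D); P \<subseteq> S; Q \<subseteq> S; D \<subseteq> S\<rbrakk>
    \<Longrightarrow> finite P \<and> card P \<le> card Q"
  using assms
proof (induction Q arbitrary: P D rule: finite_induct)
  case empty
  have "P = {}"
  proof (rule ccontr)
    assume "P \<noteq> {}"
    then obtain p where p: "p \<in> P" by auto
    then have "p \<in> cl (P - {p} \<union> D)"
      using empty cl_mono[of D "P - {p} \<union> D"] by auto
    then show False using empty p by (auto simp: indep_over_iff)
  qed
  then show ?case by simp
next
  case (insert q Q)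
  show ?case
  proof (cases "P \<subseteq> cl (Q \<union> D)")
    case True
    then show ?thesis using insert by force
  next
    case False
    then obtain p where p: "p \<in> P" "p \<notin> cl (Q \<union> D)" by auto
    have "q \<in> cl (insert p (Q \<union> D))"
      using cl_exchange[of "Q \<union> D" p q] p insert.prems by auto
    then have "insert q Q \<union> D \<subseteq> cl (insert p (Q \<union> D))"
      using cl_extensive[of "insert p (Q \<union> D)"] insert.prems p by auto
    then have "cl (insert q Q \<union> D) \<subseteq> cl (insert p (Q \<union> D))"
      using insert.prems p by (intro cl_least) auto
    then have "P - {p} \<subseteq> cl (Q \<union> insert p D)"
      using insert.prems(2) by auto
    moreover have "indep_over cl (insert p D) (P - {p})"
      unfolding indep_over_iff
    proof
      fix x assume x: "x \<in> P - {p}"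
      then have "P - {p} - {x} \<union> insert p D = P - {x} \<union> D" using p by auto
      then show "x \<notin> cl (P - {p} - {x} \<union> insert p D)"
        using insert.prems(1) x by (simp add: indep_over_iff)
    qed
    moreover have "P - {p} \<subseteq> S" "Q \<subseteq> S" "insert p D \<subseteq> S" using insert.prems p by auto
    ultimately have "finite (P - {p}) \<and> card (P - {p}) \<le> card Q"
      by (metis insert.IH)
    then show ?thesis
      using p(1) insert.hyps by (auto simp: card_Diff_singleton_if)
  qed
qed

lemma augment:
  assumes "finite Q" "indep_over cl D P" "card Q < card P" "P \<subseteq> S" "Q \<subseteq> S" "D \<subseteq> S"
  obtains p where "p \<in> P" "p \<notin> cl (Q \<union> D)"
  using steinitz_card_le[OF assms(1,2)] assms(3-6) by fastforce

text \<open>Points independent over a big set \<open>V\<close> cannot help a small set \<open>U \<subseteq> V\<close> to generate an element of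
  \<open>V\<close>: were \<open>q\<close> needed for \<open>x\<close>, exchange would express \<open>q\<close> through \<open>x\<close> and the remaining points.\<close>

lemma cl_drop_indep:
  assumes "finite Q"
  shows "\<lbrakk>indep_over cl V Q; x \<in> V; x \<in> cl (Q \<union> U); U \<subseteq> V; V \<subseteq> S; Q \<subseteq> S\<rbrakk> \<Longrightarrow> x \<in> cl U"
  using assms
proof (induction Q rule: finite_induct)
  case (insert q Q)
  show ?case
  proof (cases "x \<in> cl (Q \<union> U)")
    case True
    moreover have "indep_over cl V Q"
      using indep_over_subset[OF insert.prems(1), of Q] insert.prems by blast
    ultimately show ?thesis using insert.prems by (intro insert.IH) auto
  next
    case False
    have "Q \<union> U \<subseteq> S" "q \<in> S" "x \<in> S" using insert.prems by auto
    then have "q \<in> cl (insert x (Q \<union> U))"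
      using cl_exchange[of "Q \<union> U" x q] False insert.prems by simp
    then have "q \<in> cl (insert q Q - {q} \<union> V)"
      using insert.prems insert.hyps by (elim in_cl_mono) auto
    then show ?thesis using insert.prems(1) by (auto simp: indep_over_iff)
  qed
qed simp

lemma basis_over_exists:
  assumes "finite X" "X \<subseteq> S" "D \<subseteq> S"
  obtains Y where "cl_basis (localize cl D) X Y"
proof -
  from assms have "\<exists>Y\<subseteq>X. indep_over cl D Y \<and> X \<subseteq> cl (Y \<union> D)"
  proof (induction X rule: finite_induct)
    case empty
    then show ?case by (auto simp: cl_indep_def)
  next
    case (insert x X)
    then obtain Y where Y: "Y \<subseteq> X" "indep_over cl D Y" "X \<subseteq> cl (Y \<union> D)" by auto
    show ?case
    proof (cases "x \<in> cl (Y \<union> D)")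
      case True
      then show ?thesis using Y by blast
    next
      case False
      have "indep_over cl D (insert x Y)"
        using False Y insert.prems by (intro indep_over_insert) auto
      moreover have "insert x Y \<union> D \<subseteq> S" using Y insert.prems by auto
      then have "X \<subseteq> cl (insert x Y \<union> D)" "x \<in> cl (insert x Y \<union> D)"
        using Y(3) cl_extensive[of "insert x Y \<union> D"] cl_mono[of "Y \<union> D" "insert x Y \<union> D"]
        by (blast, blast)
      ultimately show ?thesis using Y(1) by (intro exI[of _ "insert x Y"]) auto
    qed
  qed
  then show thesis using that by (auto simp: cl_basis_def localize_def)
qed

text \<open>This is the form in which \<open>H\<close>-independence is used. A finite set that is independent over \<open>D\<close> is
  its own only basis over \<open>D\<close>, so its dimension there is its cardinality; equality of dimensions
  then forces the basis over \<open>D'\<close>, whichever one is chosen, to be the whole set as well.\<close>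

lemma indep_over_of_cl_dim_eq:
  assumes "finite Y" "Y \<subseteq> S" "D \<subseteq> S" "D' \<subseteq> S" and ind: "indep_over cl D Y"
    and eq: "cl_dim (localize cl D) Y = cl_dim (localize cl D') Y"
  shows "indep_over cl D' Y"
proof -
  have only: "Z = Y" if "cl_basis (localize cl D) Y Z" for Z
  proof (rule ccontr)
    have "Z \<subseteq> Y" using that by (simp add: cl_basis_def)
    moreover assume "Z \<noteq> Y"
    ultimately obtain y where y: "y \<in> Y" "y \<notin> Z" by blast
    have "y \<in> cl (Z \<union> D)" using that y by (auto simp: cl_basis_def localize_def)
    moreover have "Z \<union> D \<subseteq> Y - {y} \<union> D" using that y by (auto simp: cl_basis_def)
    ultimately have "y \<in> cl (Y - {y} \<union> D)" using assms(2,3) by (elim in_cl_mono) auto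
    then show False using ind y by (auto simp: indep_over_iff)
  qed
  have ex: "\<exists>Z. cl_basis (localize cl D) Y Z" "\<exists>Z. cl_basis (localize cl D') Y Z"
    using basis_over_exists assms(1-4) by metis+
  have "cl_dim (localize cl D) Y = card Y"
    using only[OF someI_ex[OF ex(1)]] by (simp add: cl_dim_def)
  moreover define Z where "Z = (SOME Z. cl_basis (localize cl D') Y Z)"
  ultimately have Z: "cl_basis (localize cl D') Y Z" "card Z = card Y"
    using eq someI_ex[OF ex(2)] by (auto simp: cl_dim_def)
  then have "Z = Y" using card_subset_eq[OF assms(1)] by (simp add: cl_basis_def)
  then show ?thesis using Z(1) by (simp add: cl_basis_def)
qed

end

section \<open>Partial isomorphisms\<close>

lemma val_map_tm: "val M e (map_tm (\<lambda>f. f) h t) = val M (\<lambda>i. e (h i)) t"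
proof (induction t)
  case (App f ts)
  then have "map (\<lambda>t. val M e (map_tm (\<lambda>f. f) h t)) ts = map (val M (\<lambda>i. e (h i))) ts" by simp
  then show ?case by (simp add: comp_def del: map_eq_conv)
qed simp

lemma wf_map_tm: "wf_tm L (map_tm (\<lambda>f. f) h t) = wf_tm L t"
  by (induction t) auto

lemma qfree_map_fm: "qfree (map_fm (\<lambda>f. f) (\<lambda>r. r) h \<phi>) = qfree \<phi>"
  by (induction \<phi>) auto

lemma wf_map_fm: "qfree \<phi> \<Longrightarrow> wf_fm L (map_fm (\<lambda>f. f) (\<lambda>r. r) h \<phi>) = wf_fm L \<phi>"
  by (induction \<phi>) (auto simp: wf_map_tm)

lemma fvars_map_fm: "qfree \<phi> \<Longrightarrow> fvars (map_fm (\<lambda>f. f) (\<lambda>r. r) h \<phi>) = h ` fvars \<phi>"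
  by (induction \<phi>) (auto simp: tm.set_map)

lemma sat_map_fm:
  "qfree \<phi> \<Longrightarrow> sat M (map_fm (\<lambda>f. f) (\<lambda>r. r) h \<phi>) e = sat M \<phi> (\<lambda>i. e (h i))"
  by (induction \<phi>) (auto simp: val_map_tm comp_def)

lemma val_cong: "(\<And>i. i \<in> tvars t \<Longrightarrow> e i = e' i) \<Longrightarrow> val M e t = val M e' t"
proof (induction t)
  case (App f ts)
  then have "map (val M e) ts = map (val M e') ts" by auto
  then show ?case by (simp del: map_eq_conv)
qed simp

lemma sat_cong:
  "qfree \<phi> \<Longrightarrow> (\<And>i. i \<in> fvars \<phi> \<Longrightarrow> e i = e' i) \<Longrightarrow> sat M \<phi> e = sat M \<phi> e'"
proof (induction \<phi>)
  case (Eq s t)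
  then show ?case using val_cong[of s e e' M] val_cong[of t e e' M] by simp
next
  case (Rel r ts)
  have "map (val M e) ts = map (val M e') ts"
    using Rel by (auto intro: val_cong)
  then show ?case by (simp del: map_eq_conv)
qed auto

lemma finite_tvars: "finite (tvars t)"
  by (induction t) auto

lemma finite_fvars: "qfree \<phi> \<Longrightarrow> finite (fvars \<phi>)"
  by (induction \<phi>) (auto simp: finite_tvars)

text \<open>Assignments over one countable variable set suffice, because a quantifier-free formula in any
  other variables can be renamed. Injectivity and single-valuedness are built in, as the case of equations
  between variables.\<close>

definition partial_iso ::
  "('f, 'r) lang \<Rightarrow> ('f, 'r, 'a, 'z) struc_scheme \<Rightarrow> ('f, 'r, 'b, 'y) struc_scheme
     \<Rightarrow> ('a \<times> 'b) set \<Rightarrow> bool" where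
  "partial_iso L M N R \<longleftrightarrow> R \<subseteq> univ M \<times> univ N \<and>
     (\<forall>(\<phi> :: ('f, 'r, nat) fm) e e'. wf_fm L \<phi> \<and> qfree \<phi> \<and> (\<forall>i\<in>fvars \<phi>. (e i, e' i) \<in> R)
        \<longrightarrow> sat M \<phi> e = sat N \<phi> e')"

lemma partial_iso_sat:
  fixes \<phi> :: "('f, 'r, 'v::countable) fm"
  assumes R: "partial_iso L M N R" and \<phi>: "wf_fm L \<phi>" "qfree \<phi>"
    and e: "\<And>i. i \<in> fvars \<phi> \<Longrightarrow> (e i, e' i) \<in> R"
  shows "sat M \<phi> e = sat N \<phi> e'"
proof -
  let ?\<psi> = "map_fm (\<lambda>f. f) (\<lambda>r. r) to_nat \<phi>"
  have "sat M ?\<psi> (\<lambda>i. e (from_nat i)) = sat N ?\<psi> (\<lambda>i. e' (from_nat i))"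
    using R \<phi> e unfolding partial_iso_def
    by (auto simp: qfree_map_fm wf_map_fm fvars_map_fm)
  then show ?thesis
    by (simp add: sat_map_fm \<phi>)
qed

text \<open>The bridge to the axioms, which speak about types of enumerations. From right to left, a formula
  whose variables are assigned pairs from the relation is renamed so that each variable becomes an
  index at which its pair is enumerated.\<close>

lemma partial_iso_iff_qftp:
  fixes L :: "('f, 'r) lang"
    and I :: "'v::countable set"
  assumes "e ` I \<subseteq> univ M" "e' ` I \<subseteq> univ N"
  shows "partial_iso L M N ((\<lambda>i. (e i, e' i)) ` I) \<longleftrightarrow> qftp L M I e = qftp L N I e'"
    (is "partial_iso L M N ?R \<longleftrightarrow> _")
proof
  assume "partial_iso L M N ?R"
  then have "sat M \<phi> e = sat N \<phi> e'" if "wf_fm L \<phi>" "qfree \<phi>" "fvars \<phi> \<subseteq> I"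
    for \<phi> :: "('f, 'r, 'v) fm"
    by (rule partial_iso_sat) (use that in auto)
  then show "qftp L M I e = qftp L N I e'"
    unfolding qftp_def by blast
next
  assume q: "qftp L M I e = qftp L N I e'"
  show "partial_iso L M N ?R"
    unfolding partial_iso_def
  proof (intro conjI allI impI; (elim conjE)?)
    show "?R \<subseteq> univ M \<times> univ N" using assms by auto
    fix \<phi> :: "('f, 'r, nat) fm" and d d'
    assume \<phi>: "wf_fm L \<phi>" "qfree \<phi>" and d: "\<forall>i\<in>fvars \<phi>. (d i, d' i) \<in> ?R"
    then have "\<forall>i\<in>fvars \<phi>. \<exists>j. j \<in> I \<and> d i = e j \<and> d' i = e' j" by fastforce
    then obtain h where h: "\<And>i. i \<in> fvars \<phi> \<Longrightarrow> h i \<in> I \<and> d i = e (h i) \<and> d' i = e' (h i)"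
      by metis
    let ?\<psi> = "map_fm (\<lambda>f. f) (\<lambda>r. r) h \<phi>"
    have "?\<psi> \<in> qftp L M I e \<longleftrightarrow> ?\<psi> \<in> qftp L N I e'" using q by simp
    then have "sat M ?\<psi> e = sat N ?\<psi> e'"
      using \<phi> h by (auto simp: qftp_def qfree_map_fm wf_map_fm fvars_map_fm)
    then have "sat M \<phi> (\<lambda>i. e (h i)) = sat N \<phi> (\<lambda>i. e' (h i))" using \<phi> by (simp add: sat_map_fm)
    moreover have "sat M \<phi> (\<lambda>i. e (h i)) = sat M \<phi> d" "sat N \<phi> (\<lambda>i. e' (h i)) = sat N \<phi> d'"
      using h \<phi> by (auto intro!: sat_cong)
    ultimately show "sat M \<phi> d = sat N \<phi> d'" by simp
  qed
qed

lemma partial_iso_subset: "partial_iso L M N R \<Longrightarrow> R' \<subseteq> R \<Longrightarrow> partial_iso L M N R'"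
  unfolding partial_iso_def by (meson subset_iff)

lemma partial_iso_converse: "partial_iso L M N R \<Longrightarrow> partial_iso L N M (R\<inverse>)"
  unfolding partial_iso_def by (auto 4 3)

lemma partial_iso_Id_on: "A \<subseteq> univ M \<Longrightarrow> partial_iso L M M (Id_on A)"
  unfolding partial_iso_def by (auto simp: Id_on_iff intro!: sat_cong)

lemma partial_iso_relcomp:
  assumes "partial_iso L M N R" "partial_iso L N K T"
  shows "partial_iso L M K (R O T)"
  unfolding partial_iso_def
proof (intro conjI allI impI; (elim conjE)?)
  show "R O T \<subseteq> univ M \<times> univ K" using assms by (auto simp: partial_iso_def)
  fix \<phi> :: "('a, 'b, nat) fm" and e e''
  assume \<phi>: "wf_fm L \<phi>" "qfree \<phi>" and e: "\<forall>i\<in>fvars \<phi>. (e i, e'' i) \<in> R O T"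
  then have "\<forall>i\<in>fvars \<phi>. \<exists>b. (e i, b) \<in> R \<and> (b, e'' i) \<in> T" by auto
  then obtain e' where "\<forall>i\<in>fvars \<phi>. (e i, e' i) \<in> R \<and> (e' i, e'' i) \<in> T" by metis
  then have "sat M \<phi> e = sat N \<phi> e'" "sat N \<phi> e' = sat K \<phi> e''"
    using partial_iso_sat[OF assms(1) \<phi>] partial_iso_sat[OF assms(2) \<phi>] by auto
  then show "sat M \<phi> e = sat K \<phi> e''" by simp
qed

lemma finite_subset_UN_chain:
  fixes R :: "nat \<Rightarrow> 'a set"
  assumes "finite X" "X \<subseteq> (\<Union>n. R n)" "mono R"
  obtains n where "X \<subseteq> R n"
proof -
  from assms(1,2) have "\<exists>n. X \<subseteq> R n"
  proof (induction X rule: finite_induct)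
    case (insert x X)
    then obtain n m where "X \<subseteq> R n" "x \<in> R m" by auto
    then have "insert x X \<subseteq> R (max n m)"
      using monoD[OF assms(3), of n "max n m"] monoD[OF assms(3), of m "max n m"] by auto
    then show ?case by blast
  qed simp
  then show thesis using that by blast
qed

text \<open>A quantifier-free formula has finitely many variables, so any instance of it already lives at
  one stage of the chain.\<close>

lemma partial_iso_UN:
  fixes R :: "nat \<Rightarrow> ('a \<times> 'b) set"
  assumes "\<And>n. partial_iso L M N (R n)" "mono R"
  shows "partial_iso (L :: ('c, 'd) lang) M N (\<Union>n. R n)"
  unfolding partial_iso_def
proof (intro conjI allI impI; (elim conjE)?)
  show "(\<Union>n. R n) \<subseteq> univ M \<times> univ N" using assms by (auto simp: partial_iso_def)
  fix \<phi> :: "('c, 'd, nat) fm" and e :: "nat \<Rightarrow> 'a" and e' :: "nat \<Rightarrow> 'b"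
  assume \<phi>: "wf_fm L \<phi>" "qfree \<phi>" and e: "\<forall>i\<in>fvars \<phi>. (e i, e' i) \<in> (\<Union>n. R n)"
  have "finite ((\<lambda>i. (e i, e' i)) ` fvars \<phi>)" using finite_fvars[OF \<phi>(2)] by simp
  then obtain n where "(\<lambda>i. (e i, e' i)) ` fvars \<phi> \<subseteq> R n"
    using finite_subset_UN_chain[of "(\<lambda>i. (e i, e' i)) ` fvars \<phi>" R] e assms(2) by blast
  then show "sat M \<phi> e = sat N \<phi> e'"
    by (intro partial_iso_sat[OF assms(1)[of n] \<phi>]) auto
qed

lemma partial_iso_eq_iff:
  assumes "partial_iso L M N R" "(a, b) \<in> R" "(a', b') \<in> R"
  shows "a = a' \<longleftrightarrow> b = b'"
  using partial_iso_sat[OF assms(1), of "Eq (Var (0::nat)) (Var 1)"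
      "\<lambda>i. if i = 0 then a else a'" "\<lambda>i. if i = 0 then b else b'"] assms(2,3)
  by simp

text \<open>The equation \<open>y = f(x\<^sub>1, \<dots>, x\<^sub>n)\<close> is an atomic formula, with \<open>y\<close> as variable \<open>0\<close> and \<open>x\<^sub>i\<close> as
  variable \<open>i\<close>; hence the index shift.\<close>

lemma partial_iso_fun:
  assumes R: "partial_iso L M N R" and f: "f \<in> Funs L" "length ps = far L f"
    and ps: "set ps \<subseteq> R" and y: "(y, y') \<in> R"
  shows "y = fun_of M f (map fst ps) \<longleftrightarrow> y' = fun_of N f (map snd ps)"
proof -
  let ?t = "App f (map (\<lambda>i. Var (Suc i)) [0..<length ps])"
  let ?e = "case_nat y (\<lambda>i. fst (ps ! i))" and ?e' = "case_nat y' (\<lambda>i. snd (ps ! i))"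
  have l: "map (val K (case_nat z (\<lambda>i. g (ps ! i)))) (map (\<lambda>i. Var (Suc i)) [0..<length ps])
      = map g ps" for g z K
    by (intro nth_equalityI) auto
  have "sat M (Eq (Var 0) ?t) ?e = sat N (Eq (Var 0) ?t) ?e'"
    using f ps y by (intro partial_iso_sat[OF R]) (auto dest!: nth_mem)
  then show ?thesis by (simp only: sat.simps val.simps l) simp
qed

lemma embedding_val:
  assumes em: "embedding L \<theta> M N" and st: "is_struc L M"
  shows "\<lbrakk>wf_tm L t; \<And>i. i \<in> tvars t \<Longrightarrow> e i \<in> univ M \<and> e' i = \<theta> (e i)\<rbrakk>
    \<Longrightarrow> val M e t \<in> univ M \<and> val N e' t = \<theta> (val M e t)"
proof (induction t)
  case (App f ts)
  have IH: "val M e t \<in> univ M \<and> val N e' t = \<theta> (val M e t)" if "t \<in> set ts" for t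
    using App that by auto
  have f: "f \<in> Funs L" "length (map (val M e) ts) = far L f" "set (map (val M e) ts) \<subseteq> univ M"
    using App IH by auto
  have "map (val N e') ts = map \<theta> (map (val M e) ts)" using IH by auto
  then show ?case
    using f em st unfolding embedding_def is_struc_def by (metis val.simps(2))
qed simp

lemma embedding_partial_iso:
  assumes em: "embedding L \<theta> M N" and st: "is_struc L M"
  shows "partial_iso L M N ((\<lambda>x. (x, \<theta> x)) ` univ M)" (is "partial_iso L M N ?R")
  unfolding partial_iso_def
proof (intro conjI allI impI; (elim conjE)?)
  show "?R \<subseteq> univ M \<times> univ N" using em by (auto simp: embedding_def)
  fix \<phi> :: "('a, 'b, nat) fm" and e e'
  assume "wf_fm L \<phi>" "qfree \<phi>" and "\<forall>i\<in>fvars \<phi>. (e i, e' i) \<in> ?R"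
  then show "sat M \<phi> e = sat N \<phi> e'"
  proof (induction \<phi>)
    case (Eq s t)
    have v: "val M e s \<in> univ M \<and> val N e' s = \<theta> (val M e s)"
      "val M e t \<in> univ M \<and> val N e' t = \<theta> (val M e t)"
      using Eq by (auto intro!: embedding_val[OF em st])
    then show ?case using em unfolding embedding_def inj_on_def by auto
  next
    case (Rel r ts)
    have v: "val M e t \<in> univ M \<and> val N e' t = \<theta> (val M e t)" if "t \<in> set ts" for t
      using Rel that by (intro embedding_val[OF em st]) auto
    have "r \<in> Rels L" "length (map (val M e) ts) = rar L r" "set (map (val M e) ts) \<subseteq> univ M"
      using Rel v by auto
    moreover have "map (val N e') ts = map \<theta> (map (val M e) ts)" using v by auto
    ultimately show ?case using em unfolding embedding_def by (metis sat.simps(2))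
  qed auto
qed

section \<open>Extending partial isomorphisms of a quasiminimal pregeometry structure\<close>

text \<open>What the counting argument needs from a member of a quasiminimal class, phrased for partial
  isomorphisms. The last assumption combines the uniqueness of the generic type over a countable closed
  set with the homogeneity of closures over it. All of this can be
  checked inside countable closed sets, so it can be pulled back along embeddings of such sets into
  another structure.\<close>

locale generic_homogeneous = pregeometry "univ M" "Cl M"
  for L :: "('f, 'r) lang" and M :: "('f, 'r, 'a) pgstruc" +
  assumes fun_in_cl: "\<lbrakk>f \<in> Funs L; set xs \<subseteq> univ M; length xs = far L f\<rbrakk>
      \<Longrightarrow> fun_of M f xs \<in> Cl M (set xs)"
    and countable_cl_finite: "\<lbrakk>finite A; A \<subseteq> univ M\<rbrakk> \<Longrightarrow> countable (Cl M A)"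
    and cl_transfer: "\<lbrakk>partial_iso L M M R; T \<subseteq> R; (a, a') \<in> R; a \<in> Cl M (Domain T)\<rbrakk>
      \<Longrightarrow> a' \<in> Cl M (Range T)"
    and generic_extension: "\<lbrakk>partial_iso L M M R; countable (Domain R); countable (Range R);
        Cl M (Domain R) = Domain R; Cl M (Range R) = Range R;
        a \<in> univ M - Domain R; a' \<in> univ M - Range R\<rbrakk>
      \<Longrightarrow> \<exists>R'. insert (a, a') R \<subseteq> R' \<and> partial_iso L M M R' \<and>
            Domain R' = Cl M (insert a (Domain R)) \<and> Range R' = Cl M (insert a' (Range R))"

context weakly_quasiminimal
begin

text \<open>QM1, which is about finite tuples, extends to arbitrary sets because the closure is finitary.\<close>

lemma closure_transfer:
  assumes R: "partial_iso L M M R" and "T \<subseteq> R" and a: "(a, a') \<in> R" "a \<in> Cl M (Domain T)"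
  shows "a' \<in> Cl M (Range T)"
proof -
  have Rsub: "R \<subseteq> univ M \<times> univ M" using R by (simp add: partial_iso_def)
  then have sub: "Domain T \<subseteq> univ M" "Range T \<subseteq> univ M" using \<open>T \<subseteq> R\<close> by auto
  obtain F where F: "finite F" "F \<subseteq> Domain T" "a \<in> Cl M F"
    using cl_finitary[OF sub(1) a(2)] by auto
  obtain T0 where T0: "T0 \<subseteq> T" "finite T0" "F = fst ` T0"
    using finite_subset_image[OF F(1), of fst T] F(2) by (auto simp: Domain_fst)
  obtain ps where ps: "set ps = T0" using finite_list[OF T0(2)] by auto
  define qs where "qs = (a, a') # ps"
  have qs: "set qs \<subseteq> R" using ps T0 \<open>T \<subseteq> R\<close> a by (auto simp: qs_def)
  have img: "(\<lambda>i. (map fst qs ! i, map snd qs ! i)) ` {..<length qs} = set qs"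
  proof -
    have "(\<lambda>i. (map fst qs ! i, map snd qs ! i)) ` {..<length qs} = (\<lambda>i. qs ! i) ` {..<length qs}"
      by (intro image_cong) auto
    then show ?thesis by (auto simp: set_conv_nth)
  qed
  have "partial_iso L M M ((\<lambda>i. (map fst qs ! i, map snd qs ! i)) ` {..<length qs})"
    unfolding img by (rule partial_iso_subset[OF R qs])
  then have "qftp_list L M (map fst qs) = qftp_list L M (map snd qs)"
    unfolding qftp_list_def length_map
    by (subst (asm) partial_iso_iff_qftp) (use qs Rsub in \<open>auto dest!: nth_mem\<close>)
  then have "qftp_list L M (a # map fst ps) = qftp_list L M (a' # map snd ps)"
    by (simp add: qs_def)
  moreover have "set (a # map fst ps) \<subseteq> univ M" "set (a' # map snd ps) \<subseteq> univ M"
    using qs Rsub by (auto simp: qs_def)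
  ultimately have "a \<in> Cl M (set (map fst ps)) \<longleftrightarrow> a' \<in> Cl M (set (map snd ps))"
    by (intro QM1) auto
  then have "a' \<in> Cl M (snd ` T0)" using F T0 ps by simp
  then show ?thesis
    by (rule in_cl_mono) (use T0 sub in \<open>auto simp: Range_snd\<close>)
qed

lemma enumerate_pairs:
  assumes "countable R"
  obtains e e' :: "nat \<Rightarrow> 'b" and I :: "nat set" where "(\<lambda>i. (e i, e' i)) ` I = R"
proof
  show "(\<lambda>i. (fst (from_nat_into R i), snd (from_nat_into R i))) ` (to_nat_on R ` R) = R"
    using assms by (force simp: image_image)
qed

text \<open>A countable relation \<open>R\<close> plays the role of the enumerated sets \<open>A\<close>, \<open>A'\<close> in QM4 and QM5, and a
  list \<open>ps\<close> of pairs that of the tuples \<open>bs\<close>, \<open>bs'\<close>.\<close>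

lemma qftp_app_iff:
  assumes R: "(\<lambda>i. (e i, e' i)) ` I = R" and "R \<subseteq> univ M \<times> univ M" "set ps \<subseteq> univ M \<times> univ M"
  shows "partial_iso L M M (R \<union> set ps) \<longleftrightarrow>
    qftp_app L M I e (map fst ps) = qftp_app L M I e' (map snd ps)"
proof -
  let ?d = "case_sum e (\<lambda>i. map fst ps ! i)" and ?d' = "case_sum e' (\<lambda>i. map snd ps ! i)"
  let ?I = "I <+> {..<length ps}"
  have "(\<lambda>i. (?d i, ?d' i)) ` ?I =
      (\<lambda>i. (e i, e' i)) ` I \<union> (\<lambda>i. ps ! i) ` {..<length ps}"
    unfolding Plus_def image_Un image_image by (intro arg_cong2[where f = "(\<union>)"] image_cong) auto
  also have "\<dots> = R \<union> set ps" using R by (auto simp: set_conv_nth)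
  finally have img: "(\<lambda>i. (?d i, ?d' i)) ` ?I = R \<union> set ps" .
  have "fst ` (\<lambda>i. (?d i, ?d' i)) ` ?I \<subseteq> univ M" "snd ` (\<lambda>i. (?d i, ?d' i)) ` ?I \<subseteq> univ M"
    unfolding img using assms by auto
  then have "?d ` ?I \<subseteq> univ M" "?d' ` ?I \<subseteq> univ M"
    by (simp_all add: image_image)
  from partial_iso_iff_qftp[OF this, of L] show ?thesis
    unfolding img by (simp add: qftp_app_def)
qed

lemma partial_iso_insert_generic:
  assumes R: "partial_iso L M M R" and cnt: "countable (Domain R)" "countable (Range R)"
    and cl: "Cl M (Domain R) = Domain R" "Cl M (Range R) = Range R"
    and a: "a \<in> univ M - Domain R" "a' \<in> univ M - Range R"
  shows "partial_iso L M M (insert (a, a') R)"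
proof -
  have Rsub: "R \<subseteq> univ M \<times> univ M" using R by (simp add: partial_iso_def)
  have "countable R"
    by (rule countable_subset[of _ "Domain R \<times> Range R"]) (use cnt in auto)
  then obtain e e' and I :: "nat set" where I: "(\<lambda>i. (e i, e' i)) ` I = R"
    by (rule enumerate_pairs)
  have img: "e ` I = Domain R" "e' ` I = Range R"
    unfolding Domain_fst Range_snd I[symmetric] by (simp_all add: image_image)
  have sub: "Domain R \<subseteq> univ M" "Range R \<subseteq> univ M" using Rsub by auto
  have "qftp L M I e = qftp L M I e'"
    using partial_iso_iff_qftp[of e I M e' M L] R I img sub by simp
  then have "qftp_app L M I e [a] = qftp_app L M I e' [a']"
    using QM4[OF sub cl img] a by simp
  then show ?thesis
    using qftp_app_iff[OF I Rsub, of "[(a, a')]"] a by simp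
qed

lemma partial_iso_insert_algebraic:
  assumes R: "partial_iso L M M (R \<union> P)" and cnt: "countable (Domain R)" "countable (Range R)"
    and cl: "Cl M (Domain R) = Domain R" "Cl M (Range R) = Range R"
    and P: "finite P" and c: "c \<in> Cl M (Domain (R \<union> P))"
  obtains c' where "partial_iso L M M (insert (c, c') (R \<union> P))" "c' \<in> Cl M (Range (R \<union> P))"
proof -
  have Rsub: "R \<union> P \<subseteq> univ M \<times> univ M" using R by (simp add: partial_iso_def)
  have "countable R"
    by (rule countable_subset[of _ "Domain R \<times> Range R"]) (use cnt in auto)
  then obtain e e' and I :: "nat set" where I: "(\<lambda>i. (e i, e' i)) ` I = R"
    by (rule enumerate_pairs)
  obtain ps where ps: "set ps = P" using finite_list[OF P] by auto
  have img: "e ` I = Domain R" "e' ` I = Range R"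
    unfolding Domain_fst Range_snd I[symmetric] by (simp_all add: image_image)
  have sub: "Domain R \<subseteq> univ M" "Range R \<subseteq> univ M" using Rsub by auto
  have subp: "set (map fst ps) \<subseteq> univ M" "set (map snd ps) \<subseteq> univ M" using Rsub ps by auto
  have "qftp L M I e = qftp L M I e'"
    using partial_iso_iff_qftp[of e I M e' M L] partial_iso_subset[OF R, of R] I img sub by simp
  moreover have "qftp_app L M I e (map fst ps) = qftp_app L M I e' (map snd ps)"
    using qftp_app_iff[OF I, of ps] Rsub ps R by simp
  moreover have "c \<in> Cl M (Domain R \<union> set (map fst ps))"
    using c ps by (simp add: Domain_fst image_Un)
  ultimately obtain c' where c': "c' \<in> univ M"
    "qftp_app L M I e (map fst ps @ [c]) = qftp_app L M I e' (map snd ps @ [c'])"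
    using QM5[OF sub disjI1[OF cl(1)] disjI1[OF cl(2)] img _ subp, of c] by auto
  have "c \<in> univ M" using c cl_subset[of "Domain (R \<union> P)"] Rsub by auto
  then have new: "partial_iso L M M (insert (c, c') (R \<union> P))"
    using qftp_app_iff[OF I, of "ps @ [(c, c')]"] c' Rsub ps by simp
  moreover have "c' \<in> Cl M (Range (R \<union> P))"
    by (rule closure_transfer[OF new _ _ c]) auto
  ultimately show thesis by (rule that)
qed

text \<open>After QM4 has matched \<open>a\<close> with \<open>a'\<close>, the closures on both sides are countable, and QM5 adds their
  elements alternately, one at a time. Every stage adds only a finite set \<open>P\<close> of pairs to \<open>R\<close>, as QM5 permits only
  finite tuples over the closed set.\<close>

lemma generic_back_and_forth:
  assumes R: "partial_iso L M M R" and cnt: "countable (Domain R)" "countable (Range R)"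
    and cl: "Cl M (Domain R) = Domain R" "Cl M (Range R) = Range R"
    and a: "a \<in> univ M - Domain R" "a' \<in> univ M - Range R"
  shows "\<exists>R'. insert (a, a') R \<subseteq> R' \<and> partial_iso L M M R' \<and>
    Domain R' = Cl M (insert a (Domain R)) \<and> Range R' = Cl M (insert a' (Range R))"
proof -
  let ?C = "Cl M (insert a (Domain R))" and ?C' = "Cl M (insert a' (Range R))"
  have Rsub: "R \<subseteq> univ M \<times> univ M" using R by (simp add: partial_iso_def)
  have sub: "insert a (Domain R) \<subseteq> univ M" "insert a' (Range R) \<subseteq> univ M" using Rsub a by auto
  have "countable ?C" "countable ?C'"
    by (rule countable_cl; use sub cnt QM3 in simp)+
  moreover have ne: "a \<in> ?C" "a' \<in> ?C'" using cl_extensive sub by blast+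
  ultimately have rng: "range (from_nat_into ?C) = ?C" "range (from_nat_into ?C') = ?C'"
    by (metis range_from_nat_into empty_iff)+
  define good where "good = (\<lambda>P. finite P \<and> (a, a') \<in> P \<and> P \<subseteq> ?C \<times> ?C' \<and> partial_iso L M M (R \<union> P))"
  have clsub: "Cl M X \<subseteq> ?C" if "X \<subseteq> ?C" for X using that sub by (intro cl_least) auto
  have clsub': "Cl M X \<subseteq> ?C'" if "X \<subseteq> ?C'" for X using that sub by (intro cl_least) auto
  have ext: "Domain R \<subseteq> ?C" "Range R \<subseteq> ?C'" using cl_extensive sub by blast+
  have eqC: "Cl M (Domain (R \<union> P)) = ?C" "Cl M (Range (R \<union> P)) = ?C'" if "good P" for P
  proof -
    have "Domain (R \<union> P) \<subseteq> ?C" "Range (R \<union> P) \<subseteq> ?C'"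
      using that ext by (auto simp: good_def)
    moreover have "insert a (Domain R) \<subseteq> Domain (R \<union> P)" "insert a' (Range R) \<subseteq> Range (R \<union> P)"
      using that by (auto simp: good_def)
    moreover have "Domain (R \<union> P) \<subseteq> univ M" "Range (R \<union> P) \<subseteq> univ M"
      using that Rsub unfolding good_def partial_iso_def by auto
    ultimately show "Cl M (Domain (R \<union> P)) = ?C" "Cl M (Range (R \<union> P)) = ?C'"
      using clsub[of "Domain (R \<union> P)"] clsub'[of "Range (R \<union> P)"]
        cl_mono[of "insert a (Domain R)" "Domain (R \<union> P)"]
        cl_mono[of "insert a' (Range R)" "Range (R \<union> P)"] by (blast, blast)
  qed
  have forth: "\<exists>Q. good Q \<and> P \<subseteq> Q \<and> c \<in> Domain Q" if P: "good P" and c: "c \<in> ?C" for P c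
  proof -
    have "partial_iso L M M (R \<union> P)" "finite P" using P by (auto simp: good_def)
    then obtain c' where c': "partial_iso L M M (insert (c, c') (R \<union> P))"
      "c' \<in> Cl M (Range (R \<union> P))"
      using c by (metis partial_iso_insert_algebraic[OF _ cnt cl] eqC(1)[OF P])
    then have "good (insert (c, c') P)" using P c eqC(2)[OF P] by (auto simp: good_def)
    then show ?thesis by (intro exI[of _ "insert (c, c') P"]) auto
  qed
  have backward: "\<exists>Q. good Q \<and> P \<subseteq> Q \<and> d \<in> Range Q" if P: "good P" and d: "d \<in> ?C'" for P d
  proof -
    have "partial_iso L M M (R\<inverse> \<union> P\<inverse>)" "finite (P\<inverse>)"
      using P partial_iso_converse[of L M M "R \<union> P"] by (auto simp: good_def converse_Un)
    moreover have "Cl M (Domain (R\<inverse> \<union> P\<inverse>)) = ?C'" "Cl M (Range (R\<inverse> \<union> P\<inverse>)) = ?C"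
      using eqC[OF P] by (simp_all flip: converse_Un)
    ultimately obtain c where c: "partial_iso L M M (insert (d, c) (R\<inverse> \<union> P\<inverse>))" "c \<in> ?C"
      using d partial_iso_insert_algebraic[of "R\<inverse>" "P\<inverse>" d] cnt cl by auto
    have "(insert (d, c) (R\<inverse> \<union> P\<inverse>))\<inverse> = R \<union> insert (c, d) P" by auto
    then have "partial_iso L M M (R \<union> insert (c, d) P)"
      using partial_iso_converse[OF c(1)] by simp
    then have "good (insert (c, d) P)" using P c(2) d by (auto simp: good_def)
    then show ?thesis by (intro exI[of _ "insert (c, d) P"]) auto
  qed
  have start: "good {(a, a')}"
    using partial_iso_insert_generic[OF assms] ne by (simp add: good_def)
  have step: "\<exists>Q. good Q \<and> (P \<subseteq> Q \<and> from_nat_into ?C n \<in> Domain Q \<and> from_nat_into ?C' n \<in> Range Q)"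
    if P: "good P" for P n
  proof -
    obtain Q where Q: "good Q" "P \<subseteq> Q" "from_nat_into ?C n \<in> Domain Q"
      using forth[OF P, of "from_nat_into ?C n"] rng(1) by blast
    obtain Q' where "good Q'" "Q \<subseteq> Q'" "from_nat_into ?C' n \<in> Range Q'"
      using backward[OF Q(1), of "from_nat_into ?C' n"] rng(2) by blast
    then show ?thesis using Q by (intro exI[of _ Q']) auto
  qed
  obtain P where P: "\<And>n. good (P n)" and
    Pn: "\<And>n. P n \<subseteq> P (Suc n) \<and> from_nat_into ?C n \<in> Domain (P (Suc n)) \<and>
      from_nat_into ?C' n \<in> Range (P (Suc n))"
    using dependent_nat_choice[of "\<lambda>_. good"
        "\<lambda>n P Q. P \<subseteq> Q \<and> from_nat_into ?C n \<in> Domain Q \<and> from_nat_into ?C' n \<in> Range Q"]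
      start step by metis
  have mono: "mono (\<lambda>n. R \<union> P n)"
    using Pn by (intro mono_iff_le_Suc[THEN iffD2]) auto
  let ?R' = "\<Union>n. R \<union> P n"
  have "partial_iso L M M ?R'"
    using P by (intro partial_iso_UN[OF _ mono]) (simp add: good_def)
  moreover have "insert (a, a') R \<subseteq> ?R'" using P by (auto simp: good_def)
  moreover have "Domain ?R' = ?C"
  proof
    show "Domain ?R' \<subseteq> ?C" using P ext by (auto simp: good_def)
    have "from_nat_into ?C n \<in> Domain ?R'" for n using Pn[of n] by auto
    then show "?C \<subseteq> Domain ?R'" using rng(1) by (metis image_subset_iff)
  qed
  moreover have "Range ?R' = ?C'"
  proof
    show "Range ?R' \<subseteq> ?C'" using P ext by (auto simp: good_def)
    have "from_nat_into ?C' n \<in> Range ?R'" for n using Pn[of n] by auto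
    then show "?C' \<subseteq> Range ?R'" using rng(2) by (metis image_subset_iff)
  qed
  ultimately show ?thesis by blast
qed

end

text \<open>A finite set lies in the closure of finitely many points of an infinite basis, and any other
  point of that basis is outside.\<close>

lemma (in quasiminimal) exists_outside_cl_finite:
  assumes "finite F" "F \<subseteq> univ M"
  obtains u where "u \<in> univ M" "u \<notin> Cl M F"
proof -
  obtain Y where Y: "Y \<subseteq> univ M" "cl_indep (Cl M) Y" "univ M \<subseteq> Cl M Y" "infinite Y"
    using QM2 by (auto simp: infinite_dimensional_def cl_basis_def)
  have "\<forall>x\<in>F. \<exists>G. finite G \<and> G \<subseteq> Y \<and> x \<in> Cl M G"
    using cl_finitary[OF Y(1)] Y(3) assms(2) by blast
  then obtain G where G: "\<And>x. x \<in> F \<Longrightarrow> finite (G x) \<and> G x \<subseteq> Y \<and> x \<in> Cl M (G x)" by metis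
  let ?Z = "\<Union>x\<in>F. G x"
  have Z: "finite ?Z" "?Z \<subseteq> Y" using G assms(1) by auto
  then obtain y where y: "y \<in> Y" "y \<notin> ?Z"
    using Y(4) by (meson finite_subset subsetI)
  have "x \<in> Cl M ?Z" if "x \<in> F" for x
  proof (rule in_cl_mono)
    show "x \<in> Cl M (G x)" using G[OF that] by simp
    show "G x \<subseteq> ?Z" using that by blast
    show "?Z \<subseteq> univ M" using Z(2) Y(1) by (rule subset_trans)
  qed
  then have FZ: "Cl M F \<subseteq> Cl M ?Z" using Z(2) Y(1) by (intro cl_least) auto
  have "y \<notin> Cl M (Y - {y})" using Y(2) y(1) by (simp add: cl_indep_def)
  moreover have "Cl M ?Z \<subseteq> Cl M (Y - {y})" using Z(2) y Y(1) by (intro cl_mono) auto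
  ultimately show thesis using that[of y] FZ y(1) Y(1) by blast
qed

text \<open>Closed sets are substructures for the following reason. If \<open>y = f(xs)\<close> were outside
  \<open>A = cl xs\<close>, then by uniqueness of the generic type over \<open>A\<close> every point outside \<open>A\<close> would
  also equal \<open>f(xs)\<close>; but in infinite dimension there are at least two such points.\<close>

lemma (in quasiminimal) generic_homogeneous: "generic_homogeneous L M"
proof unfold_locales
  fix f xs
  assume f: "f \<in> Funs L" "set xs \<subseteq> univ M" "length xs = far L f"
  show "fun_of M f xs \<in> Cl M (set xs)"
  proof (rule ccontr)
    let ?y = "fun_of M f xs" and ?A = "Cl M (set xs)"
    assume y: "?y \<notin> ?A"
    have yM: "?y \<in> univ M" using is_struc f by (simp add: is_struc_def)
    obtain z where z: "z \<in> univ M" "z \<notin> Cl M (insert ?y (set xs))"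
      using exists_outside_cl_finite[of "insert ?y (set xs)"] f yM by auto
    have A: "?A \<subseteq> univ M" "Cl M ?A = ?A" "countable ?A" "set xs \<subseteq> ?A"
      using f cl_subset cl_idem QM3 cl_extensive by auto
    have "z \<notin> ?A" "z \<noteq> ?y"
      using z(2) cl_mono[of "set xs" "insert ?y (set xs)"] cl_extensive[of "insert ?y (set xs)"] f yM
      by auto
    then have "partial_iso L M M (insert (?y, z) (Id_on ?A))"
      using A y yM z by (intro partial_iso_insert_generic partial_iso_Id_on) auto
    from partial_iso_fun[OF this f(1), of "map (\<lambda>x. (x, x)) xs" ?y z]
    have "z = fun_of M f xs" using A(4) f by (auto simp: comp_def)
    then show False using \<open>z \<noteq> ?y\<close> by simp
  qed
next
  show "countable (Cl M A)" if "finite A" "A \<subseteq> univ M" for A using QM3 that by simp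
  show "a' \<in> Cl M (Range T)"
    if "partial_iso L M M R" "T \<subseteq> R" "(a, a') \<in> R" "a \<in> Cl M (Domain T)" for R T a a'
    using closure_transfer that by blast
qed (rule generic_back_and_forth)

section \<open>Members of the generated class\<close>

text \<open>A relation between different structures may preserve types without respecting the closure operators,
  so the last clause demands it; within one structure QM1 yields it.\<close>

definition closed_iso ::
  "('f, 'r) lang \<Rightarrow> ('f, 'r, 'a) pgstruc \<Rightarrow> ('f, 'r, 'b) pgstruc \<Rightarrow> ('a \<times> 'b) set \<Rightarrow> bool" where
  "closed_iso L M N R \<longleftrightarrow> partial_iso L M N R \<and>
     Cl M (Domain R) = Domain R \<and> Cl N (Range R) = Range R \<and>
     (\<forall>T\<subseteq>R. \<forall>(a, b)\<in>R. a \<in> Cl M (Domain T) \<longleftrightarrow> b \<in> Cl N (Range T))"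

lemma closed_isoD:
  assumes "closed_iso L M N R"
  shows "partial_iso L M N R" "Cl M (Domain R) = Domain R" "Cl N (Range R) = Range R"
    "Domain R \<subseteq> univ M" "Range R \<subseteq> univ N"
    "T \<subseteq> R \<Longrightarrow> (a, b) \<in> R \<Longrightarrow> a \<in> Cl M (Domain T) \<longleftrightarrow> b \<in> Cl N (Range T)"
  using assms by (auto simp: closed_iso_def partial_iso_def)

lemma closed_iso_converse:
  assumes "closed_iso L M N R" shows "closed_iso L N M (R\<inverse>)"
  unfolding closed_iso_def
proof (intro conjI allI impI ballI, goal_cases)
  case 1
  then show ?case using assms by (simp add: closed_iso_def partial_iso_converse)
next
  case (4 T x)
  then have "T\<inverse> \<subseteq> R" by auto
  then show ?case using closed_isoD(6)[OF assms, of "T\<inverse>"] 4 by auto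
qed (use assms in \<open>auto simp: closed_iso_def\<close>)

lemma closed_iso_relcomp:
  assumes R: "closed_iso L M N R" and T: "closed_iso L N K T" and eq: "Range R = Domain T"
  shows "closed_iso L M K (R O T)" "Domain (R O T) = Domain R" "Range (R O T) = Range T"
proof -
  show dr: "Domain (R O T) = Domain R" "Range (R O T) = Range T"
    using eq by (blast, blast)
  show "closed_iso L M K (R O T)"
    unfolding closed_iso_def dr
  proof (intro conjI allI impI ballI, goal_cases)
    case (4 S x)
    then obtain a b c where x: "x = (a, c)" "(a, b) \<in> R" "(b, c) \<in> T" by auto
    define S1 where "S1 = {(u, v) \<in> R. \<exists>w. (u, w) \<in> S \<and> (v, w) \<in> T}"
    define S2 where "S2 = {(v, w) \<in> T. \<exists>u. (u, w) \<in> S \<and> (u, v) \<in> R}"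
    have "Domain S1 = Domain S" "Range S2 = Range S" "Range S1 = Domain S2"
      using 4(1) by (auto simp: S1_def S2_def) blast+
    moreover have "a \<in> Cl M (Domain S1) \<longleftrightarrow> b \<in> Cl N (Range S1)"
      by (rule closed_isoD(6)[OF R]) (auto simp: S1_def x)
    moreover have "b \<in> Cl N (Domain S2) \<longleftrightarrow> c \<in> Cl K (Range S2)"
      by (rule closed_isoD(6)[OF T]) (auto simp: S2_def x)
    ultimately show ?case by (simp add: x)
  qed (use R T in \<open>auto simp: closed_iso_def intro: partial_iso_relcomp\<close>)
qed

text \<open>The last clause of the definition, applied to \<open>T\<close>, pairs the elements of the closure on one side with
  those of the closure on the other.\<close>

lemma closed_iso_restrict:
  assumes M: "pregeometry (univ M) (Cl M)" and N: "pregeometry (univ N) (Cl N)"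
    and R: "closed_iso L M N R" and "T \<subseteq> R"
  obtains R0 where "R0 \<subseteq> R" "T \<subseteq> R0" "closed_iso L M N R0" "Domain R0 = Cl M (Domain T)"
    "Range R0 = Cl N (Range T)"
proof -
  interpret M: pregeometry "univ M" "Cl M" by (rule M)
  interpret N: pregeometry "univ N" "Cl N" by (rule N)
  note D = closed_isoD[OF R]
  define R0 where "R0 = {(a, b) \<in> R. a \<in> Cl M (Domain T)}"
  have sub: "Domain T \<subseteq> Domain R" "Range T \<subseteq> Range R" using \<open>T \<subseteq> R\<close> by auto
  have sub': "Domain T \<subseteq> univ M" "Range T \<subseteq> univ N" using sub D by auto
  have c: "Cl M (Domain T) \<subseteq> Domain R" "Cl N (Range T) \<subseteq> Range R"
    using M.cl_mono[OF sub(1)] N.cl_mono[OF sub(2)] D(2-5) by auto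
  have dom: "Domain R0 = Cl M (Domain T)" using c by (auto simp: R0_def)
  have ran: "Range R0 = Cl N (Range T)"
    using c D(6)[OF \<open>T \<subseteq> R\<close>] unfolding R0_def by blast
  have R0: "R0 \<subseteq> R" by (auto simp: R0_def)
  show thesis
  proof (rule that[OF R0 _ _ dom ran])
    show "T \<subseteq> R0" using \<open>T \<subseteq> R\<close> M.cl_extensive[OF sub'(1)] by (auto simp: R0_def)
    have "x \<in> Cl M (Domain T') \<longleftrightarrow> y \<in> Cl N (Range T')" if "T' \<subseteq> R0" "(x, y) \<in> R0" for T' x y
      using D(6)[of T' x y] that R0 by blast
    then show "closed_iso L M N R0"
      unfolding closed_iso_def dom ran
      using M.cl_idem[OF sub'(1)] N.cl_idem[OF sub'(2)] partial_iso_subset[OF D(1) R0] by blast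
  qed
qed

lemma Domain_restrict: "A \<subseteq> Domain R \<Longrightarrow> Domain (R \<inter> A \<times> UNIV) = A"
  by blast

lemma partial_iso_function:
  assumes "partial_iso L M N R"
  shows "R = (\<lambda>x. (x, SOME y. (x, y) \<in> R)) ` Domain R"
proof -
  have y: "(x, SOME y. (x, y) \<in> R) \<in> R" if "x \<in> Domain R" for x
    using that by (auto intro: someI)
  moreover have "p \<in> (\<lambda>x. (x, SOME y. (x, y) \<in> R)) ` Domain R" if "p \<in> R" for p
  proof -
    have "fst p \<in> Domain R" using that by (auto simp: Domain_fst)
    moreover have "p = (fst p, SOME y. (fst p, y) \<in> R)"
      using partial_iso_eq_iff[OF assms, of "fst p" "snd p" "fst p"] that y[OF calculation]
      by (auto simp: prod_eq_iff)
    ultimately show ?thesis by (rule rev_image_eqI)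
  qed
  ultimately show ?thesis by auto
qed

lemma partial_iso_finite_Range:
  "partial_iso L M N R \<Longrightarrow> finite (Domain R) \<Longrightarrow> finite (Range R)"
  by (subst partial_iso_function) (auto simp: Range_snd)

lemma partial_iso_countable_Range:
  "partial_iso L M N R \<Longrightarrow> countable (Domain R) \<Longrightarrow> countable (Range R)"
  by (subst partial_iso_function) (auto simp: Range_snd)

lemma closed_iso_Range:
  assumes M: "pregeometry (univ M) (Cl M)" and N: "pregeometry (univ N) (Cl N)"
    and R: "closed_iso L M N R" and T: "T \<subseteq> R" "Domain R = Cl M (Domain T)"
  shows "Range R = Cl N (Range T)"
proof
  interpret N: pregeometry "univ N" "Cl N" by (rule N)
  note D = closed_isoD[OF R]
  show "Range R \<subseteq> Cl N (Range T)" using D(6)[OF T(1)] T(2) by auto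
  have "Range T \<subseteq> Range R" using T(1) by auto
  then show "Cl N (Range T) \<subseteq> Range R" using N.cl_mono[OF _ D(5)] D(3) by auto
qed

lemma (in generic_homogeneous) closed_isoI:
  assumes "partial_iso L M M R" "Cl M (Domain R) = Domain R" "Cl M (Range R) = Range R"
  shows "closed_iso L M M R"
proof -
  have "a \<in> Cl M (Domain T) \<longleftrightarrow> b \<in> Cl M (Range T)" if T: "T \<subseteq> R" "(a, b) \<in> R" for T a b
  proof
    show "b \<in> Cl M (Range T)" if "a \<in> Cl M (Domain T)"
      by (rule cl_transfer[OF assms(1) T that])
    have "T\<inverse> \<subseteq> R\<inverse>" "(b, a) \<in> R\<inverse>" using T by auto
    then show "a \<in> Cl M (Domain T)" if "b \<in> Cl M (Range T)"
      using cl_transfer[OF partial_iso_converse[OF assms(1)], of "T\<inverse>" b a] that by simp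
  qed
  then show ?thesis using assms by (auto simp: closed_iso_def)
qed

lemma closed_iso_Id_on:
  assumes "pregeometry (univ M) (Cl M)" "A \<subseteq> univ M" "Cl M A = A"
  shows "closed_iso L M M (Id_on A)"
proof -
  have "Domain T = Range T" if "T \<subseteq> Id_on A" for T using that by auto
  then show ?thesis using assms by (auto simp: closed_iso_def partial_iso_Id_on)
qed

lemma closed_iso_UN:
  fixes R :: "nat \<Rightarrow> _"
  assumes M: "pregeometry (univ M) (Cl M)" and N: "pregeometry (univ N) (Cl N)"
    and R: "\<And>n. closed_iso L M N (R n)" and mono: "mono R"
  shows "closed_iso L M N (\<Union>n. R n)"
proof -
  interpret M: pregeometry "univ M" "Cl M" by (rule M)
  interpret N: pregeometry "univ N" "Cl N" by (rule N)
  let ?U = "\<Union>n. R n"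
  have sub: "Domain ?U \<subseteq> univ M" "Range ?U \<subseteq> univ N"
    using closed_isoD(4,5)[OF R] by blast+
  have 1: "b \<in> Cl N (Range T) \<and> b \<in> Range ?U"
    if T: "T \<subseteq> ?U" and a: "(a, b) \<in> ?U" "a \<in> Cl M (Domain T)" for T a b
  proof -
    have subT: "Domain T \<subseteq> univ M" "Range T \<subseteq> univ N" using T sub by blast+
    obtain F where F: "finite F" "F \<subseteq> fst ` T" "a \<in> Cl M F"
      using M.cl_finitary[OF subT(1) a(2)] by (auto simp: Domain_fst)
    obtain T0 where T0: "T0 \<subseteq> T" "finite T0" "F = fst ` T0"
      using finite_subset_image[OF F(1,2)] by auto
    obtain n where n: "insert (a, b) T0 \<subseteq> R n"
      by (rule finite_subset_UN_chain[of "insert (a, b) T0" R]) (use T0 T a mono in auto)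
    then have "b \<in> Cl N (Range T0)"
      using closed_isoD(6)[OF R[of n], of T0 a b] F T0 by (auto simp: Domain_fst)
    moreover have "Range T0 \<subseteq> Range T" using T0 by auto
    ultimately show ?thesis using subT a by (auto dest: N.in_cl_mono)
  qed
  have 2: "a \<in> Cl M (Domain T) \<and> a \<in> Domain ?U"
    if T: "T \<subseteq> ?U" and a: "(a, b) \<in> ?U" "b \<in> Cl N (Range T)" for T a b
  proof -
    have subT: "Domain T \<subseteq> univ M" "Range T \<subseteq> univ N" using T sub by blast+
    obtain F where F: "finite F" "F \<subseteq> snd ` T" "b \<in> Cl N F"
      using N.cl_finitary[OF subT(2) a(2)] by (auto simp: Range_snd)
    obtain T0 where T0: "T0 \<subseteq> T" "finite T0" "F = snd ` T0"
      using finite_subset_image[OF F(1,2)] by auto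
    obtain n where n: "insert (a, b) T0 \<subseteq> R n"
      by (rule finite_subset_UN_chain[of "insert (a, b) T0" R]) (use T0 T a mono in auto)
    then have "a \<in> Cl M (Domain T0)"
      using closed_isoD(6)[OF R[of n], of T0 a b] F T0 by (auto simp: Range_snd)
    moreover have "Domain T0 \<subseteq> Domain T" using T0 by auto
    ultimately show ?thesis using subT a by (auto dest: M.in_cl_mono)
  qed
  have "Cl M (Domain ?U) \<subseteq> Domain ?U"
  proof
    fix a assume "a \<in> Cl M (Domain ?U)"
    then obtain F where F: "finite F" "F \<subseteq> fst ` ?U" "a \<in> Cl M F"
      using M.cl_finitary[OF sub(1)] by (auto simp: Domain_fst)
    obtain T0 where T0: "T0 \<subseteq> ?U" "finite T0" "F = fst ` T0"
      using finite_subset_image[OF F(1,2)] by auto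
    obtain n where n: "T0 \<subseteq> R n"
      using finite_subset_UN_chain[OF T0(2,1) mono] .
    have "F \<subseteq> Domain (R n)" using n T0 by (auto simp: Domain_fst)
    then have "a \<in> Cl M (Domain (R n))"
      using F(3) closed_isoD(4)[OF R[of n]] by (elim M.in_cl_mono)
    then show "a \<in> Domain ?U" using closed_isoD(2)[OF R[of n]] by auto
  qed
  moreover have "Cl N (Range ?U) \<subseteq> Range ?U"
  proof
    fix a assume "a \<in> Cl N (Range ?U)"
    then obtain F where F: "finite F" "F \<subseteq> snd ` ?U" "a \<in> Cl N F"
      using N.cl_finitary[OF sub(2)] by (auto simp: Range_snd)
    obtain T0 where T0: "T0 \<subseteq> ?U" "finite T0" "F = snd ` T0"
      using finite_subset_image[OF F(1,2)] by auto
    obtain n where n: "T0 \<subseteq> R n"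
      using finite_subset_UN_chain[OF T0(2,1) mono] .
    have "F \<subseteq> Range (R n)" using n T0 by (auto simp: Range_snd)
    then have "a \<in> Cl N (Range (R n))"
      using F(3) closed_isoD(5)[OF R[of n]] by (elim N.in_cl_mono)
    then show "a \<in> Range ?U" using closed_isoD(3)[OF R[of n]] by auto
  qed
  ultimately have "Cl M (Domain ?U) = Domain ?U" "Cl N (Range ?U) = Range ?U"
    using M.cl_extensive[OF sub(1)] N.cl_extensive[OF sub(2)] by auto
  moreover have "partial_iso L M N ?U"
    by (rule partial_iso_UN[OF _ mono]) (rule closed_isoD(1)[OF R])
  moreover have "\<forall>T\<subseteq>?U. \<forall>(a, b)\<in>?U. a \<in> Cl M (Domain T) \<longleftrightarrow> b \<in> Cl N (Range T)"
    using 1 2 by (intro allI impI ballI) (simp only: split_paired_all prod.case, metis)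
  ultimately show ?thesis
    unfolding closed_iso_def by (intro conjI)
qed

lemma closed_embedding_closed_iso:
  assumes em: "closed_embedding L \<theta> M N" and st: "is_struc L M"
    and M: "pregeometry (univ M) (Cl M)"
  shows "closed_iso L M N ((\<lambda>x. (x, \<theta> x)) ` univ M)" (is "closed_iso L M N ?R")
proof -
  interpret M: pregeometry "univ M" "Cl M" by (rule M)
  have cl: "\<theta> ` Cl M A = Cl N (\<theta> ` A)" if "A \<subseteq> univ M" for A
    using em that by (simp add: closed_embedding_def)
  have inj: "inj_on \<theta> (univ M)" using em by (simp add: closed_embedding_def embedding_def)
  have dr: "Domain ?R = univ M" "Range ?R = \<theta> ` univ M" by (auto simp: Domain_fst Range_snd image_image)
  have u: "Cl M (univ M) = univ M" using M.cl_extensive[of "univ M"] M.cl_subset[of "univ M"] by auto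
  have "a \<in> Cl M (Domain T) \<longleftrightarrow> b \<in> Cl N (Range T)" if T: "T \<subseteq> ?R" "(a, b) \<in> ?R" for T a b
  proof -
    have sub: "Domain T \<subseteq> univ M" and r: "Range T = \<theta> ` Domain T" using T by auto
    have "b \<in> Cl N (Range T) \<longleftrightarrow> \<theta> a \<in> \<theta> ` Cl M (Domain T)"
      using cl[OF sub] T(2) r by auto
    also have "\<dots> \<longleftrightarrow> a \<in> Cl M (Domain T)"
      using inj T(2) M.cl_subset[OF sub] by (intro inj_on_image_mem_iff) auto
    finally show ?thesis by simp
  qed
  moreover have "partial_iso L M N ?R"
    using em st by (intro embedding_partial_iso) (simp_all add: closed_embedding_def)
  ultimately show ?thesis
    unfolding closed_iso_def dr using u cl[of "univ M"] by auto
qed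

text \<open>The invariant of the induction along the generation of the class. It is confined to closures of
  finite sets since a countable closed subset of the union of a chain need not lie in any member of
  the chain.\<close>

definition locally_embeddable ::
  "('f, 'r) lang \<Rightarrow> ('f, 'r, 'a) pgstruc \<Rightarrow> ('f, 'r, 'b) pgstruc \<Rightarrow> bool" where
  "locally_embeddable L M0 N \<longleftrightarrow> pregeometry (univ N) (Cl N) \<and> is_struc L N \<and>
     (\<forall>F. finite F \<and> F \<subseteq> univ N \<longrightarrow> (\<exists>R. closed_iso L N M0 R \<and> Domain R = Cl N F))"

lemma locally_embeddableE:
  assumes "locally_embeddable L M0 N" "finite F" "F \<subseteq> univ N"
  obtains R where "closed_iso L N M0 R" "Domain R = Cl N F"
  using assms unfolding locally_embeddable_def by metis

lemma local_embedding_pullback: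
  assumes N: "pregeometry (univ N) (Cl N)" and M: "pregeometry (univ M) (Cl M)"
    and T: "closed_iso L N M T" and F: "F \<subseteq> Domain T"
    and R: "closed_iso L M M0 R" "Domain R = Cl M (T `` F)"
  shows "\<exists>R'. closed_iso L N M0 R' \<and> Domain R' = Cl N F"
proof -
  let ?S = "T \<inter> F \<times> UNIV"
  have S: "?S \<subseteq> T" "Domain ?S = F" "Range ?S = T `` F" using F by auto
  obtain T0 where "T0 \<subseteq> T" "?S \<subseteq> T0" and T0: "closed_iso L N M T0" "Domain T0 = Cl N F"
    "Range T0 = Cl M (T `` F)"
    using closed_iso_restrict[OF N M T S(1), unfolded S(2,3)] .
  then show ?thesis
    using closed_iso_relcomp[OF T0(1) R(1)] R(2) by auto
qed

lemma pregeometry_iso: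
  assumes M: "pregeometry (univ M) (Cl M)" and iso: "isomorphism L \<theta> M N"
  shows "pregeometry (univ N) (Cl N)"
proof -
  interpret M: pregeometry "univ M" "Cl M" by (rule M)
  have cl: "\<theta> ` Cl M A = Cl N (\<theta> ` A)" if "A \<subseteq> univ M" for A
    using iso that by (simp add: closed_embedding_def isomorphism_def)
  have inj: "inj_on \<theta> (univ M)" and img: "\<theta> ` univ M = univ N"
    using iso by (simp_all add: closed_embedding_def embedding_def isomorphism_def)
  have pre: "\<exists>A0\<subseteq>univ M. A = \<theta> ` A0" if "A \<subseteq> univ N" for A
    using that by (simp add: subset_image_iff flip: img)
  have mem: "\<theta> a \<in> Cl N (\<theta> ` A) \<longleftrightarrow> a \<in> Cl M A" if "a \<in> univ M" "A \<subseteq> univ M" for a A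
    using that M.cl_subset[of A] inj by (simp add: inj_on_image_mem_iff flip: cl)
  show ?thesis
  proof
    fix A assume "A \<subseteq> univ N"
    then obtain A0 where A: "A0 \<subseteq> univ M" "A = \<theta> ` A0" using pre by blast
    note clA = cl[OF A(1)] cl[OF M.cl_subset[OF A(1)]]
    show "Cl N A \<subseteq> univ N" using M.cl_subset[OF A(1)] clA img A(2) by (metis image_mono)
    show "A \<subseteq> Cl N A" using M.cl_extensive[OF A(1)] clA A(2) by (metis image_mono)
    show "Cl N (Cl N A) = Cl N A" using clA M.cl_idem[OF A(1)] A(2) by simp
    show "\<exists>F. finite F \<and> F \<subseteq> A \<and> a \<in> Cl N F" if "a \<in> Cl N A" for a
    proof -
      have "a \<in> \<theta> ` Cl M A0" using that clA A(2) by simp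
      then obtain a0 where a0: "a0 \<in> Cl M A0" "a = \<theta> a0" by auto
      then obtain F where "finite F" "F \<subseteq> A0" "a0 \<in> Cl M F" using M.cl_finitary[OF A(1)] by blast
      then show ?thesis
        using a0 A cl[of F] by (intro exI[of _ "\<theta> ` F"]) auto
    qed
    show "b \<in> Cl N (insert a A)"
      if *: "a \<in> univ N" "b \<in> univ N" "a \<in> Cl N (insert b A)" "a \<notin> Cl N A" for a b
    proof -
      obtain a0 b0 where ab: "a0 \<in> univ M" "b0 \<in> univ M" "a = \<theta> a0" "b = \<theta> b0"
        using *(1,2) img by blast
      then show ?thesis
        using *(3,4) A M.cl_exchange[OF A(1) ab(1,2)] mem[of a0 "insert b0 A0"] mem[of a0 A0]
          mem[of b0 "insert a0 A0"] by auto
    qed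
  next
    fix A A' assume "A \<subseteq> A'" "A' \<subseteq> univ N"
    obtain A0 where A0: "A0 \<subseteq> univ M" "A' = \<theta> ` A0"
      using pre[OF \<open>A' \<subseteq> univ N\<close>] by blast
    have "A \<subseteq> \<theta> ` A0" using \<open>A \<subseteq> A'\<close> A0(2) by simp
    then obtain A1 where A1: "A1 \<subseteq> A0" "A = \<theta> ` A1"
      by (auto simp only: subset_image_iff)
    show "Cl N A \<subseteq> Cl N A'"
      using image_mono[OF M.cl_mono[OF A1(1) A0(1)], of \<theta>] cl[OF A0(1)]
        cl[OF subset_trans[OF A1(1) A0(1)]] A0(2) A1(2) by simp
  qed
qed

lemma pregeometry_substruc:
  assumes M: "pregeometry (univ M) (Cl M)" and X: "X \<subseteq> univ M" "Cl M X = X"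
  shows "pregeometry X (Cl M)"
proof -
  interpret M: pregeometry "univ M" "Cl M" by (rule M)
  show ?thesis
  proof
    show "Cl M A \<subseteq> X" if "A \<subseteq> X" for A using M.cl_mono[OF that] X by auto
    show "A \<subseteq> Cl M A" if "A \<subseteq> X" for A using M.cl_extensive[of A] that X by auto
    show "Cl M A \<subseteq> Cl M A'" if "A \<subseteq> A'" "A' \<subseteq> X" for A A' using M.cl_mono[of A A'] that X by auto
    show "Cl M (Cl M A) = Cl M A" if "A \<subseteq> X" for A using M.cl_idem[of A] that X by auto
    show "\<exists>F. finite F \<and> F \<subseteq> A \<and> a \<in> Cl M F" if "A \<subseteq> X" "a \<in> Cl M A" for A a
      using M.cl_finitary[of A a] that X by auto
    show "b \<in> Cl M (insert a A)"
      if "A \<subseteq> X" "a \<in> X" "b \<in> X" "a \<in> Cl M (insert b A)" "a \<notin> Cl M A" for A a b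
      using M.cl_exchange[of A a b] that X by auto
  qed
qed

lemma closed_sub_Cl: "closed_sub L M N \<Longrightarrow> A \<subseteq> univ M \<Longrightarrow> Cl M A = Cl N A"
  by (simp add: closed_sub_def closed_embedding_def)

lemma closed_sub_univ: "closed_sub L M N \<Longrightarrow> univ M \<subseteq> univ N"
  by (simp add: closed_sub_def closed_embedding_def embedding_def)

lemma chain_union_finite_subset:
  assumes ch: "chain_union L K N" and "finite F" "F \<subseteq> univ N"
  obtains M where "M \<in> K" "F \<subseteq> univ M"
proof -
  have u: "univ N = (\<Union>M\<in>K. univ M)" and ne: "K \<noteq> {}"
    and lin: "\<And>M M'. M \<in> K \<Longrightarrow> M' \<in> K \<Longrightarrow> closed_sub L M M' \<or> closed_sub L M' M"
    using ch by (auto simp: chain_union_def)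
  from assms(2,3) have "\<exists>M\<in>K. F \<subseteq> univ M"
  proof (induction F rule: finite_induct)
    case empty
    then show ?case using ne by auto
  next
    case (insert x F)
    then obtain M M' where M: "M \<in> K" "F \<subseteq> univ M" "M' \<in> K" "x \<in> univ M'" using u by auto
    then show ?case using lin[OF M(1,3)] by (auto dest!: closed_sub_univ)
  qed
  then show thesis using that by blast
qed

text \<open>The closure prescribed for the union restricts to that of each member, because any two
  members are comparable. Every statement about finitely many points of the union can therefore be decided
  in a single member, which is how the pregeometry axioms are obtained for the union.\<close>

lemma chain_union_Cl:
  assumes ch: "chain_union L K N" and pg: "\<And>M. M \<in> K \<Longrightarrow> pregeometry (univ M) (Cl M)"
    and M: "M \<in> K" and A: "A \<subseteq> univ M"
  shows "Cl N A = Cl M A"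
proof -
  interpret M: pregeometry "univ M" "Cl M" by (rule pg[OF M])
  have lin: "\<And>M'. M' \<in> K \<Longrightarrow> closed_sub L M M' \<or> closed_sub L M' M"
    and AN: "A \<subseteq> univ N"
    using ch M A by (auto simp: chain_union_def)
  have cl: "Cl N A = \<Union>{Cl M F |M F. M \<in> K \<and> finite F \<and> F \<subseteq> A \<and> F \<subseteq> univ M}"
    using ch AN by (simp add: chain_union_def)
  show ?thesis
  proof
    show "Cl N A \<subseteq> Cl M A"
    proof
      fix a assume "a \<in> Cl N A"
      then obtain M' F where F: "M' \<in> K" "F \<subseteq> A" "F \<subseteq> univ M'" "a \<in> Cl M' F"
        unfolding cl by auto
      have "Cl M' F = Cl M F"
        using lin[OF F(1)] closed_sub_Cl[of L M M' F] closed_sub_Cl[of L M' M F] F A by auto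
      then show "a \<in> Cl M A" using F M.cl_mono[OF F(2) A] by auto
    qed
    show "Cl M A \<subseteq> Cl N A"
    proof
      fix a assume "a \<in> Cl M A"
      then obtain F where "finite F" "F \<subseteq> A" "a \<in> Cl M F" using M.cl_finitary[OF A] by auto
      then show "a \<in> Cl N A" unfolding cl using A M by blast
    qed
  qed
qed

lemma pregeometry_chain_union:
  assumes ch: "chain_union L K N" and pg: "\<And>M. M \<in> K \<Longrightarrow> pregeometry (univ M) (Cl M)"
  shows "pregeometry (univ N) (Cl N)"
proof -
  have u: "univ N = (\<Union>M\<in>K. univ M)" using ch by (simp add: chain_union_def)
  have cl: "Cl N A = \<Union>{Cl M F |M F. M \<in> K \<and> finite F \<and> F \<subseteq> A \<and> F \<subseteq> univ M}"
    if "A \<subseteq> univ N" for A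
    using ch that by (simp add: chain_union_def)
  have clM: "Cl N A = Cl M A" if "M \<in> K" "A \<subseteq> univ M" for M A
    using chain_union_Cl[OF ch pg that] .
  have fin: "\<exists>F. finite F \<and> F \<subseteq> A \<and> a \<in> Cl N F" if A: "A \<subseteq> univ N" "a \<in> Cl N A" for A a
  proof -
    obtain M F where "M \<in> K" "finite F" "F \<subseteq> A" "F \<subseteq> univ M" "a \<in> Cl M F"
      using A(2) unfolding cl[OF A(1)] by auto
    then show ?thesis using clM[of M F] by auto
  qed
  have sub: "Cl N A \<subseteq> univ N" if "A \<subseteq> univ N" for A
  proof -
    have "Cl M F \<subseteq> univ M" if "M \<in> K" "F \<subseteq> univ M" for M F
      using pregeometry.cl_subset[OF pg] that by blast
    then show ?thesis using u unfolding cl[OF that] by blast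
  qed
  have mono: "Cl N A \<subseteq> Cl N A'" if "A \<subseteq> A'" "A' \<subseteq> univ N" for A A'
    using that unfolding cl[OF that(2)] cl[OF subset_trans[OF that]] by blast
  have ext: "A \<subseteq> Cl N A" if "A \<subseteq> univ N" for A
  proof
    fix a assume a: "a \<in> A"
    have "a \<in> univ N" using a that by auto
    then obtain M where M: "M \<in> K" "a \<in> univ M" using u by auto
    then have "a \<in> Cl M {a}" using pregeometry.cl_extensive[OF pg[OF M(1)], of "{a}"] by auto
    then have "a \<in> Cl N {a}" using clM[OF M(1), of "{a}"] M by auto
    then show "a \<in> Cl N A" using mono[of "{a}" A] a that by auto
  qed
  show ?thesis
  proof
    fix A assume A: "A \<subseteq> univ N"
    show "Cl N (Cl N A) = Cl N A"
    proof
      show "Cl N A \<subseteq> Cl N (Cl N A)" using ext sub A by blast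
      show "Cl N (Cl N A) \<subseteq> Cl N A"
      proof
        fix a assume "a \<in> Cl N (Cl N A)"
        then obtain F where F: "finite F" "F \<subseteq> Cl N A" "a \<in> Cl N F"
          using fin[OF sub[OF A]] by blast
        have "\<forall>x\<in>F. \<exists>G. finite G \<and> G \<subseteq> A \<and> x \<in> Cl N G" using fin[OF A] F(2) by blast
        then obtain G where G: "\<And>x. x \<in> F \<Longrightarrow> finite (G x) \<and> G x \<subseteq> A \<and> x \<in> Cl N (G x)" by metis
        let ?G = "\<Union>x\<in>F. G x"
        have GA: "?G \<subseteq> A" "finite ?G" using G F(1) by auto
        have GN: "?G \<subseteq> univ N" using GA(1) A by (rule subset_trans)
        have FN: "F \<subseteq> univ N" using F(2) sub[OF A] by auto
        obtain M where M: "M \<in> K" "F \<union> ?G \<subseteq> univ M"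
          using chain_union_finite_subset[OF ch, of "F \<union> ?G"] F(1) FN GA(2) GN by blast
        interpret M: pregeometry "univ M" "Cl M" by (rule pg[OF M(1)])
        have "x \<in> Cl N ?G" if "x \<in> F" for x
          using G[OF that] mono[of "G x" ?G] that GA A by blast
        then have "F \<subseteq> Cl M ?G" using clM[OF M(1), of ?G] M(2) by auto
        then have "Cl M F \<subseteq> Cl M ?G" using M(2) by (intro M.cl_least) auto
        then have "a \<in> Cl N ?G" using F(3) clM[OF M(1), of ?G] clM[OF M(1), of F] M(2) by auto
        then show "a \<in> Cl N A" using mono[OF GA(1) A] by auto
      qed
    qed
    show "b \<in> Cl N (insert a A)"
      if ab: "a \<in> univ N" "b \<in> univ N" "a \<in> Cl N (insert b A)" "a \<notin> Cl N A" for a b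
    proof -
      obtain F where F: "finite F" "F \<subseteq> insert b A" "a \<in> Cl N F"
        using fin[of "insert b A" a] ab A by auto
      let ?F = "F - {b}"
      have FA: "?F \<subseteq> A" using F by auto
      obtain M where M: "M \<in> K" "insert a (insert b F) \<subseteq> univ M"
        using chain_union_finite_subset[OF ch, of "insert a (insert b F)"] F A ab by auto
      interpret M: pregeometry "univ M" "Cl M" by (rule pg[OF M(1)])
      have "a \<in> Cl M F" using F(3) clM[OF M(1), of F] M(2) by auto
      then have "a \<in> Cl M (insert b ?F)" using M(2) by (elim M.in_cl_mono) auto
      moreover have "a \<notin> Cl M ?F"
        using ab(4) mono[OF FA A] clM[OF M(1), of ?F] M(2) by auto
      moreover have "?F \<subseteq> univ M" "a \<in> univ M" "b \<in> univ M" using M(2) by auto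
      ultimately have "b \<in> Cl M (insert a ?F)"
        using M.cl_exchange[of ?F a b] by simp
      moreover have "Cl N (insert a ?F) = Cl M (insert a ?F)" using M by (intro clM) auto
      ultimately have "b \<in> Cl N (insert a ?F)" by simp
      moreover have "insert a ?F \<subseteq> insert a A" using FA by auto
      ultimately show ?thesis using mono[of "insert a ?F" "insert a A"] ab(1) A by auto
    qed
  qed (use sub ext mono fin in auto)
qed

text \<open>In each of the three closure steps, the new structure and an old one share the closure of the given
  finite set up to a closed isomorphism, so the embedding into \<open>M0\<close> is inherited by composition.\<close>

theorem generated_class_locally_embeddable:
  assumes "quasiminimal L M0" and N: "N \<in> generated_class L M0"
  shows "locally_embeddable L M0 N"
proof -
  interpret M0: quasiminimal L M0 by (rule assms(1))
  from N show ?thesis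
  proof (induction rule: generated_class.induct)
    case base
    have "closed_iso L M0 M0 (Id_on (Cl M0 F))" if "F \<subseteq> univ M0" for F
      using M0.cl_subset[OF that] M0.cl_idem[OF that] M0.pregeometry_axioms
      by (intro closed_iso_Id_on)
    moreover have "Domain (Id_on (Cl M0 F)) = Cl M0 F" for F by simp
    ultimately show ?case
      using M0.pregeometry_axioms M0.is_struc unfolding locally_embeddable_def by metis
  next
    case (iso M \<theta> N)
    then have M: "pregeometry (univ M) (Cl M)" "is_struc L M"
      by (simp_all add: locally_embeddable_def)
    have em: "closed_embedding L \<theta> M N" and img: "univ N = \<theta> ` univ M"
      using iso(2) by (simp_all add: isomorphism_def)
    have N: "pregeometry (univ N) (Cl N)" by (rule pregeometry_iso[OF M(1) iso(2)])
    let ?T = "((\<lambda>x. (x, \<theta> x)) ` univ M)\<inverse>"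
    have T: "closed_iso L N M ?T"
      using closed_embedding_closed_iso[OF em M(2,1)] by (rule closed_iso_converse)
    have "\<exists>R. closed_iso L N M0 R \<and> Domain R = Cl N F" if F: "finite F" "F \<subseteq> univ N" for F
    proof -
      obtain F0 where F0: "F0 \<subseteq> univ M" "F = \<theta> ` F0" "finite F0"
        using finite_subset_image[OF F(1), of \<theta> "univ M"] F(2) img by auto
      have TF: "?T `` F = F0"
        using em F0 by (auto simp: closed_embedding_def embedding_def inj_on_def)
      have "\<exists>R. closed_iso L M M0 R \<and> Domain R = Cl M F0"
        using iso.IH F0 by (simp add: locally_embeddable_def)
      then obtain R where "closed_iso L M M0 R" "Domain R = Cl M (?T `` F)"
        unfolding TF by auto
      moreover have "F \<subseteq> Domain ?T" using F0 by auto
      ultimately show ?thesis by (intro local_embedding_pullback[OF N M(1) T])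
    qed
    moreover have "is_struc L N"
      unfolding is_struc_def
    proof (intro ballI allI impI)
      fix f xs assume f: "f \<in> Funs L" and xs: "set xs \<subseteq> univ N \<and> length xs = far L f"
      define ys where "ys = map (inv_into (univ M) \<theta>) xs"
      have ys: "set ys \<subseteq> univ M" "xs = map \<theta> ys"
        using xs unfolding img ys_def
        by (auto simp: inv_into_into f_inv_into_f subset_iff intro!: map_idI[symmetric])
      then have "fun_of M f ys \<in> univ M" using M(2) f xs by (simp add: is_struc_def)
      moreover have "\<theta> (fun_of M f ys) = fun_of N f xs"
        using em f xs ys by (simp add: closed_embedding_def embedding_def)
      ultimately show "fun_of N f xs \<in> univ N" unfolding img by (metis imageI)
    qed
    ultimately show ?case using N by (simp add: locally_embeddable_def)
  next
    case (closed_substruc M X)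
    then have M: "pregeometry (univ M) (Cl M)" "is_struc L M"
      by (simp_all add: locally_embeddable_def)
    let ?N = "M\<lparr>univ := X\<rparr>"
    have N: "pregeometry (univ ?N) (Cl ?N)"
      using pregeometry_substruc[OF M(1) closed_substruc(2,3)] by simp
    have "closed_embedding L id ?N M"
      using closed_substruc(2) by (auto simp: closed_embedding_def embedding_def)
    then have T: "closed_iso L ?N M ((\<lambda>x. (x, id x)) ` univ ?N)" (is "closed_iso L ?N M ?T")
      using closed_substruc(4) N by (rule closed_embedding_closed_iso)
    have "\<exists>R. closed_iso L ?N M0 R \<and> Domain R = Cl ?N F" if F: "finite F" "F \<subseteq> univ ?N" for F
    proof -
      have "?T `` F = F" "F \<subseteq> Domain ?T" using F by auto
      moreover obtain R where "closed_iso L M M0 R" "Domain R = Cl M F"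
        using locally_embeddableE[OF closed_substruc.IH F(1)] F(2) closed_substruc(2) by auto
      ultimately show ?thesis using local_embedding_pullback[OF N M(1) T, of F M0 R] by simp
    qed
    then show ?case using N closed_substruc(4) by (simp add: locally_embeddable_def)
  next
    case (union K N)
    have pg: "pregeometry (univ M) (Cl M)" "is_struc L M" if "M \<in> K" for M
      using union.IH[OF that] by (simp_all add: locally_embeddable_def)
    note ch = union.hyps(2)
    have N: "pregeometry (univ N) (Cl N)" by (rule pregeometry_chain_union[OF ch pg(1)])
    have em: "embedding L id M N" if "M \<in> K" for M using ch that by (simp add: chain_union_def)
    have "\<exists>R. closed_iso L N M0 R \<and> Domain R = Cl N F" if F: "finite F" "F \<subseteq> univ N" for F
    proof -
      obtain M where M: "M \<in> K" "F \<subseteq> univ M" using chain_union_finite_subset[OF ch F] .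
      have "closed_embedding L id M N"
        using em[OF M(1)] chain_union_Cl[OF ch pg(1) M(1)] by (simp add: closed_embedding_def)
      then have T: "closed_iso L N M (((\<lambda>x. (x, id x)) ` univ M)\<inverse>)" (is "closed_iso L N M ?T")
        using pg[OF M(1)] by (intro closed_iso_converse closed_embedding_closed_iso)
      have "?T `` F = F" "F \<subseteq> Domain ?T" using M(2) by auto
      moreover obtain R where "closed_iso L M M0 R" "Domain R = Cl M F"
        using locally_embeddableE[OF union.IH[OF M(1)] F(1) M(2)] .
      ultimately show ?thesis using local_embedding_pullback[OF N pg(1)[OF M(1)] T, of F M0 R] by simp
    qed
    moreover have "is_struc L N"
      unfolding is_struc_def
    proof (intro ballI allI impI)
      fix f xs assume f: "f \<in> Funs L" and xs: "set xs \<subseteq> univ N \<and> length xs = far L f"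
      then obtain M where M: "M \<in> K" "set xs \<subseteq> univ M"
        using chain_union_finite_subset[OF ch, of "set xs"] by auto
      then have "fun_of M f xs \<in> univ M" using pg(2)[OF M(1)] f xs by (simp add: is_struc_def)
      moreover have "fun_of M f xs = fun_of N f xs" "univ M \<subseteq> univ N"
        using em[OF M(1)] f xs M by (auto simp: embedding_def)
      ultimately show "fun_of N f xs \<in> univ N" by auto
    qed
    ultimately show ?case using N by (simp add: locally_embeddable_def)
  qed
qed

text \<open>The set \<open>A\<close> is the union of the closures \<open>C\<^sub>n\<close> of its first \<open>n\<close> elements. Suppose \<open>C\<^sub>n\<close> is already embedded by
  \<open>R\<close>, and let \<open>T\<close> be any embedding of \<open>C\<^sub>n\<^sub>+\<^sub>1\<close>. The two images of \<open>C\<^sub>n\<close> in \<open>M0\<close> are isomorphic by a partial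
  isomorphism \<open>Q\<close>, and unless the next element is already in \<open>C\<^sub>n\<close>, extending \<open>Q\<close> to match its \<open>T\<close>-image with some point
  outside the image of \<open>R\<close> yields \<open>Q'\<close> such that \<open>T O Q'\<close> extends \<open>R\<close>. Such a point exists
  because the image of \<open>R\<close> is finite-dimensional and \<open>M0\<close> is not.\<close>

lemma countable_closed_embeds:
  assumes "quasiminimal L M0" and N: "locally_embeddable L M0 N"
    and A: "countable A" "A \<subseteq> univ N" "Cl N A = A"
  obtains R where "closed_iso L N M0 R" "Domain R = A"
proof (cases "A = {}")
  case True
  then show thesis using N A that unfolding locally_embeddable_def by (metis finite.emptyI)
next
  case False
  interpret M0: quasiminimal L M0 by (rule assms(1))
  interpret H0: generic_homogeneous L M0 by (rule M0.generic_homogeneous)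
  interpret N: pregeometry "univ N" "Cl N" using N by (simp add: locally_embeddable_def)
  note pg = N.pregeometry_axioms M0.pregeometry_axioms
  define a where "a = from_nat_into A"
  have ra: "range a = A" unfolding a_def using range_from_nat_into[OF False A(1)] .
  define F where "F = (\<lambda>n. a ` {..<n})"
  have F: "finite (F n)" "F n \<subseteq> A" "F n \<subseteq> univ N" "F (Suc n) = insert (a n) (F n)" for n
    using ra A by (auto simp: F_def lessThan_Suc)
  have clFA: "Cl N (F n) \<subseteq> A" for n using N.cl_mono[OF F(2) A(2)] A(3) by simp
  then have cntF: "countable (Cl N (F n))" for n using A(1) countable_subset by blast
  have step: "\<exists>R'. (closed_iso L N M0 R' \<and> Domain R' = Cl N (F (Suc n))) \<and> R \<subseteq> R'"
    if "closed_iso L N M0 R \<and> Domain R = Cl N (F n)" for R n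
  proof (cases "a n \<in> Cl N (F n)")
    case True
    then have "F (Suc n) \<subseteq> Cl N (F n)" using N.cl_extensive[OF F(3)[of n]] F(4)[of n] by simp
    then have "Cl N (F (Suc n)) \<subseteq> Cl N (F n)" by (rule N.cl_least) (rule F(3))
    moreover have "Cl N (F n) \<subseteq> Cl N (F (Suc n))" using F(3,4) by (intro N.cl_mono) auto
    ultimately show ?thesis using that by auto
  next
    case False
    have R: "closed_iso L N M0 R" "Domain R = Cl N (F n)" using that by auto
    note RD = closed_isoD[OF R(1)]
    have FR: "F n \<subseteq> Domain R" using R N.cl_extensive[OF F(3)[of n]] by simp
    let ?S' = "R \<inter> F n \<times> UNIV"
    have dS': "Domain ?S' = F n" using FR by auto
    have RR: "Range R = Cl M0 (Range ?S')"
      by (rule closed_iso_Range[OF pg R(1)]) (use dS' R in auto)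
    have finS': "finite (Range ?S')"
      using partial_iso_finite_Range[OF partial_iso_subset[OF RD(1)], of ?S'] dS' F(1) by auto
    have "Range ?S' \<subseteq> univ M0" using RD(5) by auto
    \<comment> \<open>\<open>u\<close> is to be the image of \<open>a n\<close>.\<close>
    then obtain u where u: "u \<in> univ M0" "u \<notin> Range R"
      unfolding RR using M0.exists_outside_cl_finite[OF finS'] by metis
    obtain T where T: "closed_iso L N M0 T" "Domain T = Cl N (F (Suc n))"
      using locally_embeddableE[OF N F(1,3)] .
    note TD = closed_isoD[OF T(1)]
    have FT: "F (Suc n) \<subseteq> Domain T" using T(2) N.cl_extensive[OF F(3)] by simp
    obtain t where t: "(a n, t) \<in> T" using FT F(4)[of n] by auto
    let ?S = "T \<inter> F n \<times> UNIV"
    have "F n \<subseteq> Domain T" using FT F(4)[of n] by auto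
    then have dS: "Domain ?S = F n" by auto
    have S: "?S \<subseteq> T" by auto
    obtain T0 where T0: "T0 \<subseteq> T" "?S \<subseteq> T0" "closed_iso L N M0 T0" "Domain T0 = Cl N (F n)"
      "Range T0 = Cl M0 (Range ?S)"
      using closed_iso_restrict[OF pg T(1) S, unfolded dS] .
    note T0D = closed_isoD[OF T0(3)]
    have "t \<notin> Range T0"
    proof
      assume "t \<in> Range T0"
      then obtain x where x: "(x, t) \<in> T0" by auto
      then have "x = a n" using partial_iso_eq_iff[OF TD(1), of x t "a n" t] t T0(1) by auto
      then show False using x T0(4) False by auto
    qed
    then have tt: "t \<in> univ M0 - Range T0" using TD(5) t by auto
    let ?Q = "T0\<inverse> O R"
    have Q: "closed_iso L M0 M0 ?Q" "Domain ?Q = Range T0" "Range ?Q = Range R"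
      using closed_iso_relcomp[OF closed_iso_converse[OF T0(3)] R(1)] T0(4) R by auto
    note QD = closed_isoD[OF Q(1)]
    have cnt: "countable (Range R)" "countable (Range T0)"
      using cntF R(2) T0(4) partial_iso_countable_Range[OF RD(1)] partial_iso_countable_Range[OF T0D(1)]
      by simp_all
    obtain Q' where Q': "insert (t, u) ?Q \<subseteq> Q'" "partial_iso L M0 M0 Q'"
      "Domain Q' = Cl M0 (insert t (Range T0))" "Range Q' = Cl M0 (insert u (Range R))"
      using H0.generic_extension[OF QD(1), of t u] cnt QD(2,3) Q(2,3) u tt by auto
    have sub: "insert t (Range T0) \<subseteq> univ M0" "insert u (Range R) \<subseteq> univ M0"
      using tt u RD(5) T0D(5) by auto
    have Q'c: "closed_iso L M0 M0 Q'"
      using Q' M0.cl_idem sub by (intro H0.closed_isoI) auto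
    have "Range T = Cl M0 (Range (insert (a n, t) ?S))"
      by (rule closed_iso_Range[OF pg T(1)]) (use t dS T(2) F(4) in \<open>auto simp: Domain_insert\<close>)
    also have "\<dots> = Domain Q'"
      unfolding Q'(3) T0(5) using TD(5) t
      by (simp add: Range_insert) (subst M0.cl_insert_cl; auto)
    finally have "closed_iso L N M0 (T O Q')" "Domain (T O Q') = Domain T"
      using closed_iso_relcomp[OF T(1) Q'c] by auto
    moreover have "R \<subseteq> T O Q'"
    proof
      fix p assume "p \<in> R"
      moreover obtain x y where p: "p = (x, y)" by (cases p)
      moreover have "x \<in> Domain T0" using T0(4) R(2) \<open>p \<in> R\<close> p by auto
      then obtain z where "(x, z) \<in> T0" by auto
      ultimately show "p \<in> T O Q'" using T0(1) Q'(1) by auto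
    qed
    ultimately show ?thesis using T(2) by auto
  qed
  have "F 0 \<subseteq> univ N" "finite (F 0)" by (auto simp: F_def)
  then have "\<exists>R. closed_iso L N M0 R \<and> Domain R = Cl N (F 0)"
    using N unfolding locally_embeddable_def by blast
  then obtain R where R: "\<And>n. closed_iso L N M0 (R n) \<and> Domain (R n) = Cl N (F n)"
    and inc: "\<And>n. R n \<subseteq> R (Suc n)"
    using dependent_nat_choice[of "\<lambda>n R. closed_iso L N M0 R \<and> Domain R = Cl N (F n)" "\<lambda>_. (\<subseteq>)"]
      step by metis
  show thesis
  proof
    show "closed_iso L N M0 (\<Union>n. R n)"
      using R inc by (intro closed_iso_UN[OF pg]) (auto simp: mono_iff_le_Suc)
    show "Domain (\<Union>n. R n) = A"
    proof
      have "Domain (R n) \<subseteq> A" for n using R[of n] clFA[of n] by simp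
      then show "Domain (\<Union>n. R n) \<subseteq> A" by blast
      have "a n \<in> Cl N (F (Suc n))" for n using N.cl_extensive[OF F(3)[of "Suc n"]] F(4)[of n] by auto
      then have "a n \<in> Domain (R (Suc n))" for n using R[of "Suc n"] by simp
      then have "a n \<in> Domain (\<Union>n. R n)" for n by blast
      then show "A \<subseteq> Domain (\<Union>n. R n)" using ra by blast
    qed
  qed
qed

text \<open>Each property of \<open>N\<close> is that of \<open>M0\<close>, conjugated by embeddings of the countable closed sets
  involved. Domain and range of a partial isomorphism may need different embeddings.\<close>

theorem generated_class_generic_homogeneous:
  assumes M0: "quasiminimal L M0" and N: "N \<in> generated_class L M0"
  shows "generic_homogeneous L N"
proof -
  interpret M0: quasiminimal L M0 by (rule M0)
  interpret H0: generic_homogeneous L M0 by (rule M0.generic_homogeneous)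
  have loc: "locally_embeddable L M0 N" by (rule generated_class_locally_embeddable[OF assms])
  interpret N: pregeometry "univ N" "Cl N" using loc by (simp add: locally_embeddable_def)
  note pg = N.pregeometry_axioms M0.pregeometry_axioms
  have cfin: "countable (Cl N F)" if F: "finite F" "F \<subseteq> univ N" for F
  proof -
    obtain R where R: "closed_iso L N M0 R" "Domain R = Cl N F"
      using locally_embeddableE[OF loc F] .
    note RD = closed_isoD[OF R(1)]
    let ?S = "R \<inter> F \<times> UNIV"
    have "F \<subseteq> Domain R" using R(2) N.cl_extensive[OF F(2)] by simp
    then have dS: "Domain ?S = F" by auto
    have "Range R = Cl M0 (Range ?S)" by (rule closed_iso_Range[OF pg R(1)]) (use dS R in auto)
    moreover have "finite (Range ?S)"
      using partial_iso_finite_Range[OF partial_iso_subset[OF RD(1)], of ?S] dS F(1) by auto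
    moreover have "Range ?S \<subseteq> univ M0" using RD(5) by auto
    ultimately have "countable (Range R)" using M0.QM3 by metis
    then show ?thesis
      using partial_iso_countable_Range[OF partial_iso_converse[OF RD(1)]] R(2) by simp
  qed
  have ccl: "countable (Cl N A)" if "countable A" "A \<subseteq> univ N" for A
    using N.countable_cl[OF cfin] that by blast
  have emb: "\<exists>R. closed_iso L N M0 R \<and> Domain R = Cl N A" if "countable A" "A \<subseteq> univ N" for A
    using countable_closed_embeds[OF M0 loc, of "Cl N A"] ccl that N.cl_subset N.cl_idem by metis
  show ?thesis
  proof
    show "countable (Cl N A)" if "finite A" "A \<subseteq> univ N" for A using cfin that .
  next
    fix f xs assume f: "f \<in> Funs L" and xs: "set xs \<subseteq> univ N" "length xs = far L f"
    let ?y = "fun_of N f xs"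
    have y: "?y \<in> univ N" using loc f xs by (auto simp: locally_embeddable_def is_struc_def)
    then obtain R where R: "closed_iso L N M0 R" "Domain R = Cl N (insert ?y (set xs))"
      using emb[of "insert ?y (set xs)"] xs by (metis countable_finite finite_insert finite_set insert_subset)
    note RD = closed_isoD[OF R(1)]
    have sub: "insert ?y (set xs) \<subseteq> Domain R" using R(2) N.cl_extensive[of "insert ?y (set xs)"] y xs by auto
    define g where "g x = (SOME z. (x, z) \<in> R)" for x
    have g: "(x, g x) \<in> R" if "x \<in> insert ?y (set xs)" for x
      using that sub unfolding g_def by (meson DomainE someI subsetD)
    let ?ps = "map (\<lambda>x. (x, g x)) xs"
    have ps: "set ?ps \<subseteq> R" using g by auto
    have "g ?y = fun_of M0 f (map g xs)"
      using partial_iso_fun[OF RD(1) f, of ?ps ?y "g ?y"] g xs by (auto simp: comp_def)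
    moreover have "set (map g xs) \<subseteq> univ M0" using g RD(5) by auto
    ultimately have "g ?y \<in> Cl M0 (set (map g xs))"
      using H0.fun_in_cl[OF f, of "map g xs"] xs by simp
    moreover have "Range (set ?ps) = set (map g xs)" "Domain (set ?ps) = set xs"
      by (auto simp: Range_snd Domain_fst image_image)
    ultimately show "?y \<in> Cl N (set xs)"
      using RD(6)[OF ps, of ?y "g ?y"] g by simp
  next
    fix R T a a'
    assume R: "partial_iso L N N R" and T: "T \<subseteq> R" "(a, a') \<in> R" and a: "a \<in> Cl N (Domain T)"
    have sub: "Domain T \<subseteq> univ N" "Range T \<subseteq> univ N" "a' \<in> univ N"
      using R T by (auto simp: partial_iso_def)
    obtain F where F: "finite F" "F \<subseteq> fst ` T" "a \<in> Cl N F"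
      using N.cl_finitary[OF sub(1) a] by (auto simp: Domain_fst)
    obtain T0 where T0: "T0 \<subseteq> T" "finite T0" "F = fst ` T0"
      using finite_subset_image[OF F(1,2)] by auto
    let ?T1 = "insert (a, a') T0"
    have fin: "finite (Domain ?T1)" "finite (Range ?T1)"
      using T0(2) by (auto simp: finite_Domain finite_Range)
    have sub1: "Domain ?T1 \<subseteq> univ N" "Range ?T1 \<subseteq> univ N"
      using R T0(1) T by (auto simp: partial_iso_def)
    obtain P where P: "closed_iso L N M0 P" "Domain P = Cl N (Domain ?T1)"
      using emb[OF countable_finite[OF fin(1)] sub1(1)] by auto
    obtain P' where P': "closed_iso L N M0 P'" "Domain P' = Cl N (Range ?T1)"
      using emb[OF countable_finite[OF fin(2)] sub1(2)] by auto
    \<comment> \<open>The image of \<open>R\<close> in \<open>M0\<close>, cut down to the finitely many pairs that witness \<open>a \<in> cl (Domain T)\<close>.\<close>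
    let ?Q = "P\<inverse> O ?T1 O P'"
    note PD = closed_isoD[OF P(1)] and PD' = closed_isoD[OF P'(1)]
    have Q: "partial_iso L M0 M0 ?Q"
      using partial_iso_subset[OF R, of ?T1] T T0(1) PD(1) PD'(1)
      by (intro partial_iso_relcomp partial_iso_converse) auto
    have dP: "Domain ?T1 \<subseteq> Domain P" "Range ?T1 \<subseteq> Domain P'"
      unfolding P(2) P'(2) using sub1 by (intro N.cl_extensive; simp)+
    obtain b b' where b: "(a, b) \<in> P" "(a', b') \<in> P'" using dP by auto
    let ?S = "P \<inter> Domain T0 \<times> UNIV" and ?S' = "P' \<inter> Range T0 \<times> UNIV"
    let ?W = "P\<inverse> O T0 O P'"
    have dS: "Domain ?S = Domain T0" "Domain ?S' = Range T0"
      using dP by (intro Domain_restrict; simp)+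
    have "\<exists>z. (x, z) \<in> P" if "(x, y) \<in> T0" for x y using dP that by auto
    moreover have "\<exists>z. (y, z) \<in> P'" if "(x, y) \<in> T0" for x y using dP that by auto
    ultimately have W: "Domain ?W = Range ?S" "Range ?W \<subseteq> Range ?S'" by blast+
    have "b \<in> Cl M0 (Range ?S)"
      using PD(6)[of ?S a b] b F(3) T0(3) dS by (simp add: Domain_fst)
    then have "b' \<in> Cl M0 (Range ?W)"
      using H0.cl_transfer[OF Q, of ?W b b'] b W by auto
    moreover have "Range ?S' \<subseteq> univ M0" using PD'(5) by auto
    ultimately have "b' \<in> Cl M0 (Range ?S')" using M0.in_cl_mono W(2) by blast
    then have "a' \<in> Cl N (Range T0)"
      using PD'(6)[of ?S' a' b'] b dS by simp
    moreover have "Range T0 \<subseteq> Range T" using T0(1) by auto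
    ultimately show "a' \<in> Cl N (Range T)" using N.in_cl_mono sub(2) by blast
  next
    fix R a a'
    assume R: "partial_iso L N N R" and cnt: "countable (Domain R)" "countable (Range R)"
      and cl: "Cl N (Domain R) = Domain R" "Cl N (Range R) = Range R"
      and a: "a \<in> univ N - Domain R" "a' \<in> univ N - Range R"
    have sub: "insert a (Domain R) \<subseteq> univ N" "insert a' (Range R) \<subseteq> univ N"
      using R a by (auto simp: partial_iso_def)
    obtain P where P: "closed_iso L N M0 P" "Domain P = Cl N (insert a (Domain R))"
      using emb[OF _ sub(1)] cnt by auto
    obtain P' where P': "closed_iso L N M0 P'" "Domain P' = Cl N (insert a' (Range R))"
      using emb[OF _ sub(2)] cnt by auto
    note PD = closed_isoD[OF P(1)] and PD' = closed_isoD[OF P'(1)]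
    have dP: "insert a (Domain R) \<subseteq> Domain P" "insert a' (Range R) \<subseteq> Domain P'"
      unfolding P(2) P'(2) using sub by (intro N.cl_extensive; simp)+
    obtain b b' where b: "(a, b) \<in> P" "(a', b') \<in> P'" using dP by auto
    let ?S = "P \<inter> Domain R \<times> UNIV" and ?S' = "P' \<inter> Range R \<times> UNIV"
    have dS: "Domain ?S = Domain R" "Domain ?S' = Range R"
      using dP by (intro Domain_restrict; simp)+
    have sS: "?S \<subseteq> P" "?S' \<subseteq> P'" by auto
    obtain P0 where P0: "P0 \<subseteq> P" "?S \<subseteq> P0" "closed_iso L N M0 P0" "Domain P0 = Domain R"
      "Range P0 = Cl M0 (Range ?S)"
      using closed_iso_restrict[OF pg P(1) sS(1), unfolded dS cl] .
    obtain P0' where P0': "P0' \<subseteq> P'" "?S' \<subseteq> P0'" "closed_iso L N M0 P0'" "Domain P0' = Range R"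
      "Range P0' = Cl M0 (Range ?S')"
      using closed_iso_restrict[OF pg P'(1) sS(2), unfolded dS cl] .
    note P0D = closed_isoD[OF P0(3)] and P0D' = closed_isoD[OF P0'(3)]
    \<comment> \<open>The image of \<open>R\<close> in \<open>M0\<close>; restricting \<open>P\<close> and \<open>P'\<close> first shows that its domain and range are closed.\<close>
    let ?Q = "P0\<inverse> O R O P0'"
    have Q: "partial_iso L M0 M0 ?Q" using R P0D(1) P0D'(1)
      by (intro partial_iso_relcomp partial_iso_converse)
    have dQ: "Domain ?Q = Range P0"
    proof
      show "Range P0 \<subseteq> Domain ?Q"
      proof
        fix z assume "z \<in> Range P0"
        then obtain x where x: "(x, z) \<in> P0" by auto
        then obtain y where y: "(x, y) \<in> R" using P0(4) by auto
        then obtain w where "(y, w) \<in> P0'" using P0'(4) by auto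
        then show "z \<in> Domain ?Q" using x y by auto
      qed
    qed auto
    have rQ: "Range ?Q = Range P0'"
    proof
      show "Range P0' \<subseteq> Range ?Q"
      proof
        fix z assume "z \<in> Range P0'"
        then obtain y where y: "(y, z) \<in> P0'" by auto
        then obtain x where x: "(x, y) \<in> R" using P0'(4) by auto
        then obtain w where "(x, w) \<in> P0" using P0(4) by auto
        then show "z \<in> Range ?Q" using x y by auto
      qed
    qed auto
    have "b \<notin> Range P0"
    proof
      assume "b \<in> Range P0"
      then obtain x where x: "(x, b) \<in> P0" by auto
      then have "x = a" using partial_iso_eq_iff[OF PD(1), of x b a b] b P0(1) by auto
      then show False using x P0(4) a by auto
    qed
    then have bb: "b \<in> univ M0 - Domain ?Q" using PD(5) b dQ by auto
    have "b' \<notin> Range P0'"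
    proof
      assume "b' \<in> Range P0'"
      then obtain x where x: "(x, b') \<in> P0'" by auto
      then have "x = a'" using partial_iso_eq_iff[OF PD'(1), of x b' a' b'] b P0'(1) by auto
      then show False using x P0'(4) a by auto
    qed
    then have bb': "b' \<in> univ M0 - Range ?Q" using PD'(5) b rQ by auto
    have "countable (Domain ?Q)" "countable (Range ?Q)"
      using cnt partial_iso_countable_Range[OF P0D(1)] partial_iso_countable_Range[OF P0D'(1)]
        P0(4) P0'(4) unfolding dQ rQ by simp_all
    then obtain Q' where Q': "insert (b, b') ?Q \<subseteq> Q'" "partial_iso L M0 M0 Q'"
      "Domain Q' = Cl M0 (insert b (Domain ?Q))" "Range Q' = Cl M0 (insert b' (Range ?Q))"
      using H0.generic_extension[OF Q _ _ _ _ bb bb'] P0D(3) P0D'(3) dQ rQ by auto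
    have "Range P = Cl M0 (Range (insert (a, b) ?S))"
      by (rule closed_iso_Range[OF pg P(1)]) (use b dS P(2) in \<open>auto simp: Domain_insert\<close>)
    also have "\<dots> = Domain Q'"
      unfolding Q'(3) dQ P0(5) using PD(5) b
      by (simp add: Range_insert) (subst M0.cl_insert_cl; auto)
    finally have rP: "Range P = Domain Q'" .
    have "Range P' = Cl M0 (Range (insert (a', b') ?S'))"
      by (rule closed_iso_Range[OF pg P'(1)]) (use b dS P'(2) in \<open>auto simp: Domain_insert\<close>)
    also have "\<dots> = Range Q'"
      unfolding Q'(4) rQ P0'(5) using PD'(5) b
      by (simp add: Range_insert) (subst M0.cl_insert_cl; auto)
    finally have rP': "Range P' = Range Q'" .
    let ?R' = "P O Q' O P'\<inverse>"
    have "partial_iso L N N ?R'" using PD(1) PD'(1) Q'(2)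
      by (intro partial_iso_relcomp partial_iso_converse)
    moreover have "Domain ?R' = Domain P"
    proof
      show "Domain P \<subseteq> Domain ?R'"
      proof
        fix x assume "x \<in> Domain P"
        then obtain y where y: "(x, y) \<in> P" by auto
        then obtain z where z: "(y, z) \<in> Q'" using rP by auto
        then obtain w where "(w, z) \<in> P'" using rP' by auto
        then show "x \<in> Domain ?R'" using y z by auto
      qed
    qed auto
    moreover have "Range ?R' = Domain P'"
    proof
      show "Domain P' \<subseteq> Range ?R'"
      proof
        fix x assume "x \<in> Domain P'"
        then obtain y where y: "(x, y) \<in> P'" by auto
        then obtain z where z: "(z, y) \<in> Q'" using rP' by auto
        then obtain w where "(w, z) \<in> P" using rP by auto
        then show "x \<in> Range ?R'" using y z by auto
      qed
    qed auto
    moreover have "insert (a, a') R \<subseteq> ?R'"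
    proof -
      have "(a, a') \<in> ?R'" using b Q'(1) by auto
      moreover have "(x, y) \<in> ?R'" if "(x, y) \<in> R" for x y
      proof -
        have "x \<in> Domain P0" "y \<in> Domain P0'" unfolding P0(4) P0'(4) using that by auto
        then obtain z w where z: "(x, z) \<in> P0" and w: "(y, w) \<in> P0'" by auto
        have "(z, w) \<in> Q'" using z w that Q'(1) by auto
        then show ?thesis using z w P0(1) P0'(1) by auto
      qed
      ultimately show ?thesis by auto
    qed
    ultimately show "\<exists>R'. insert (a, a') R \<subseteq> R' \<and> partial_iso L N N R' \<and>
        Domain R' = Cl N (insert a (Domain R)) \<and> Range R' = Cl N (insert a' (Range R))"
      using P(2) P'(2) by (intro exI[of _ ?R']) simp
  qed
qed

section \<open>Back and forth in the expansion\<close>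

text \<open>The last assumption is the only place where \<open>H\<close>-structures and beautiful pairs differ.\<close>

locale expansion_over = generic_homogeneous L M
  for L :: "('f, 'r) lang" and M :: "('f, 'r, 'a) pgstruc" +
  fixes H B :: "'a set"
  assumes H_sub: "H \<subseteq> univ M" and B_sub: "B \<subseteq> univ M"
    and B_closed: "Cl M B = B" and B_countable: "countable B"
    and B_indep: "H_independent M H B"
    and H_kind: "(\<forall>F. finite F \<and> F \<subseteq> H \<longrightarrow> cl_indep (Cl M) F) \<or> Cl M H = H"
begin

lemma countable_cl_countable: "countable A \<Longrightarrow> A \<subseteq> univ M \<Longrightarrow> countable (Cl M A)"
  using countable_cl countable_cl_finite by blast

text \<open>First \<open>Q\<close> is dropped, as it is independent over \<open>B \<union> H\<close>. What remains of \<open>B\<close> is a finite set, which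
  may be replaced by a basis \<open>Y\<close> over \<open>B \<inter> H\<close>. By \<open>H\<close>-independence of \<open>B\<close>, \<open>Y\<close> stays independent over
  all of \<open>H\<close>, so it can be dropped for the same reason.\<close>

lemma mem_H_cl_trace:
  assumes P: "P \<subseteq> H" and Q: "finite Q" "Q \<subseteq> univ M" "indep_over (Cl M) (B \<union> H) Q"
    and x: "x \<in> H" "x \<in> Cl M (B \<union> P \<union> Q)"
  shows "x \<in> Cl M (P \<union> (B \<inter> H))"
proof -
  have sub: "B \<union> P \<subseteq> univ M" "P \<union> (B \<inter> H) \<subseteq> univ M" using P B_sub H_sub by auto
  have "x \<in> Cl M (B \<union> P)"
    by (rule cl_drop_indep[OF Q(1,3)]) (use P Q x B_sub H_sub in \<open>auto simp: Un_commute\<close>)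
  then obtain F where F: "finite F" "F \<subseteq> B \<union> P" "x \<in> Cl M F"
    using cl_finitary[OF sub(1)] by auto
  obtain Y where Y: "cl_basis (localize (Cl M) (B \<inter> H)) (F \<inter> B) Y"
    by (rule basis_over_exists[of "F \<inter> B" "B \<inter> H"]) (use F B_sub in auto)
  then have Y': "Y \<subseteq> B" "finite Y" "F \<inter> B \<subseteq> Cl M (Y \<union> (B \<inter> H))"
    using F(1) finite_subset[of Y F] by (auto simp: cl_basis_def localize_def)
  obtain ys where ys: "set ys = Y" using finite_list[OF Y'(2)] by auto
  have "cl_dim (localize (Cl M) (B \<inter> H)) Y = cl_dim (localize (Cl M) H) Y"
    using B_indep Y'(1) unfolding H_independent_def ys[symmetric] by blast
  then have ind: "indep_over (Cl M) H Y"
    by (intro indep_over_of_cl_dim_eq[of Y "B \<inter> H" H])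
      (use Y Y' B_sub H_sub in \<open>auto simp: cl_basis_def\<close>)
  let ?Z = "Y \<union> (P \<union> (B \<inter> H))"
  have Z: "?Z \<subseteq> univ M" using Y' sub B_sub by auto
  have "Cl M (Y \<union> (B \<inter> H)) \<subseteq> Cl M ?Z" using Z by (intro cl_mono) auto
  then have "F \<subseteq> Cl M ?Z" using F(2) Y'(3) cl_extensive[OF Z] by blast
  then have "x \<in> Cl M ?Z" using F(3) cl_least[OF _ Z] by blast
  then show ?thesis
    by (rule cl_drop_indep[OF Y'(2) ind x(1)]) (use P Y' B_sub H_sub in auto)
qed

text \<open>The relation \<open>P\<close> pairs the points of \<open>H\<close> used on the two sides, as the proof that \<open>H\<close> is
  respected has to transport the closure of \<open>B \<inter> H\<close> together with these points. For the points
  independent over \<open>B \<union> H\<close>, sets \<open>Q\<close> and \<open>Q'\<close> of the same size are enough.\<close>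

definition back_forth :: "('a \<times> 'a) set \<Rightarrow> ('a \<times> 'a) set \<Rightarrow> 'a set \<Rightarrow> 'a set \<Rightarrow> bool" where
  "back_forth R P Q Q' \<longleftrightarrow>
     partial_iso L M M R \<and> Id_on B \<union> P \<subseteq> R \<and>
     finite P \<and> P \<subseteq> H \<times> H \<and> card (Domain P) = card (Range P) \<and>
     indep_over (Cl M) B (Domain P) \<and> indep_over (Cl M) B (Range P) \<and>
     finite Q \<and> finite Q' \<and> Q \<subseteq> univ M \<and> Q' \<subseteq> univ M \<and> card Q = card Q' \<and>
     indep_over (Cl M) (B \<union> H) Q \<and> indep_over (Cl M) (B \<union> H) Q' \<and>
     Domain R = Cl M (B \<union> Domain P \<union> Q) \<and> Range R = Cl M (B \<union> Range P \<union> Q')"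

lemma back_forth_converse: "back_forth R P Q Q' \<Longrightarrow> back_forth (R\<inverse>) (P\<inverse>) Q' Q"
  unfolding back_forth_def by (auto simp: partial_iso_converse)

lemma back_forth_sub:
  assumes "back_forth R P Q Q'"
  shows "B \<union> Domain P \<union> Q \<subseteq> univ M" "B \<union> Range P \<union> Q' \<subseteq> univ M"
    "countable (Domain R)" "countable (Range R)"
    "Cl M (Domain R) = Domain R" "Cl M (Range R) = Range R"
    "B \<union> Domain P \<union> Q \<subseteq> Domain R" "B \<union> Range P \<union> Q' \<subseteq> Range R"
proof -
  have d: "Domain R = Cl M (B \<union> Domain P \<union> Q)" "Range R = Cl M (B \<union> Range P \<union> Q')"
    using assms by (auto simp: back_forth_def)
  show s: "B \<union> Domain P \<union> Q \<subseteq> univ M" "B \<union> Range P \<union> Q' \<subseteq> univ M"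
    using assms B_sub H_sub unfolding back_forth_def by blast+
  have "finite (Domain P)" "finite (Range P)" "finite Q" "finite Q'"
    using assms by (auto simp: back_forth_def finite_Domain finite_Range)
  then have c: "countable (B \<union> Domain P \<union> Q)" "countable (B \<union> Range P \<union> Q')"
    using B_countable by (auto intro: countable_finite)
  show "countable (Domain R)" "countable (Range R)"
    unfolding d using c s by (blast intro: countable_cl_countable)+
  show "Cl M (Domain R) = Domain R" "Cl M (Range R) = Range R"
    unfolding d by (rule cl_idem[OF s(1)], rule cl_idem[OF s(2)])
  show "B \<union> Domain P \<union> Q \<subseteq> Domain R" "B \<union> Range P \<union> Q' \<subseteq> Range R"
    unfolding d by (rule cl_extensive[OF s(1)], rule cl_extensive[OF s(2)])
qed

lemma back_forth_H:
  assumes bf: "back_forth R P Q Q'" and xx: "(x, x') \<in> R" and x: "x \<in> H"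
  shows "x' \<in> H"
proof -
  have R: "partial_iso L M M R" and P: "P \<subseteq> H \<times> H" "P \<subseteq> R" "Id_on B \<subseteq> R"
    and Q: "finite Q" "Q \<subseteq> univ M" "indep_over (Cl M) (B \<union> H) Q"
    and dom: "Domain R = Cl M (B \<union> Domain P \<union> Q)"
    using bf by (auto simp: back_forth_def)
  \<comment> \<open>\<open>?D\<close> is the part of \<open>R\<close> that generates the trace of \<open>H\<close> on both sides.\<close>
  let ?D = "P \<union> Id_on (B \<inter> H)"
  have D: "?D \<subseteq> R" "Domain ?D = Domain P \<union> (B \<inter> H)" "Domain ?D \<subseteq> H" "Range ?D \<subseteq> H"
    using P by auto
  have "x \<in> Cl M (B \<union> Domain P \<union> Q)" using xx dom by auto
  then have xD: "x \<in> Cl M (Domain ?D)"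
    unfolding D(2) using P(1) by (intro mem_H_cl_trace[OF _ Q x]) auto
  show ?thesis
    using H_kind
  proof
    assume "Cl M H = H"
    moreover have "x' \<in> Cl M (Range ?D)" by (rule cl_transfer[OF R D(1) xx xD])
    ultimately show ?thesis using cl_mono[OF D(4) H_sub] by auto
  next
    assume ind: "\<forall>F. finite F \<and> F \<subseteq> H \<longrightarrow> cl_indep (Cl M) F"
    have DM: "Domain ?D \<subseteq> univ M" using D(3) H_sub by (rule subset_trans)
    obtain F where F: "finite F" "F \<subseteq> Domain ?D" "x \<in> Cl M F"
      using cl_finitary[OF DM xD] by auto
    have "x \<in> F"
    proof (rule ccontr)
      assume "x \<notin> F"
      moreover have "cl_indep (Cl M) (insert x F)"
        using ind F(1) x subset_trans[OF F(2) D(3)] by simp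
      ultimately show False using F(3) by (simp add: cl_indep_def)
    qed
    then have "x \<in> Domain ?D" using F(2) by auto
    then obtain y where y: "(x, y) \<in> ?D" by auto
    then have "(x, y) \<in> R" "y \<in> H" using D by auto
    then show ?thesis using partial_iso_eq_iff[OF R xx] by auto
  qed
qed

lemma back_forth_H_iff:
  assumes "back_forth R P Q Q'" "(x, x') \<in> R"
  shows "x \<in> H \<longleftrightarrow> x' \<in> H"
  using back_forth_H[OF assms] back_forth_H[OF back_forth_converse[OF assms(1)], of x' x] assms(2)
  by auto

lemma back_forth_insert_H:
  assumes bf: "back_forth R P Q Q'"
    and p: "p \<in> H" "p \<notin> Domain R" and p': "p' \<in> H" "p' \<notin> Range R"
  shows "\<exists>R'. R \<subseteq> R' \<and> back_forth R' (insert (p, p') P) Q Q'"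
proof -
  note s = back_forth_sub[OF bf]
  note b = bf[unfolded back_forth_def]
  have pM: "p \<in> univ M" "p' \<in> univ M" using p p' H_sub by auto
  obtain R' where R': "insert (p, p') R \<subseteq> R'" "partial_iso L M M R'"
    "Domain R' = Cl M (insert p (Domain R))" "Range R' = Cl M (insert p' (Range R))"
    using generic_extension[of R p p'] b s(3-6) p p' pM by auto
  have "B \<union> Domain (insert (p, p') P) \<union> Q = insert p (B \<union> Domain P \<union> Q)"
    "B \<union> Range (insert (p, p') P) \<union> Q' = insert p' (B \<union> Range P \<union> Q')" by auto
  then have dr: "Domain R' = Cl M (B \<union> Domain (insert (p, p') P) \<union> Q)"
    "Range R' = Cl M (B \<union> Range (insert (p, p') P) \<union> Q')"
    using R'(3,4) b cl_insert_cl[OF s(1) pM(1)] cl_insert_cl[OF s(2) pM(2)] by simp_all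
  have "Cl M (Domain P \<union> B) \<subseteq> Cl M (B \<union> Domain P \<union> Q)"
    "Cl M (Range P \<union> B) \<subseteq> Cl M (B \<union> Range P \<union> Q')"
    by (rule cl_mono[OF _ s(1)], blast) (rule cl_mono[OF _ s(2)], blast)
  then have "indep_over (Cl M) B (insert p (Domain P))" "indep_over (Cl M) B (insert p' (Range P))"
    using b p p' pM s(1,2) by (auto intro!: indep_over_insert)
  moreover have "p \<notin> Domain P" "p' \<notin> Range P" using s(7,8) p p' by auto
  then have "card (insert p (Domain P)) = card (insert p' (Range P))"
    using b by (simp add: finite_Domain finite_Range)
  ultimately have "back_forth R' (insert (p, p') P) Q Q'"
    unfolding back_forth_def using b R' dr p(1) p'(1)
    by (simp add: Domain_insert Range_insert) blast
  then show ?thesis using R'(1) by auto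
qed

lemma back_forth_insert_generic:
  assumes bf: "back_forth R P Q Q'"
    and q: "q \<in> univ M" "q \<notin> Cl M (Q \<union> (B \<union> H))" and q': "q' \<in> univ M" "q' \<notin> Cl M (Q' \<union> (B \<union> H))"
  shows "\<exists>R'. R \<subseteq> R' \<and> back_forth R' P (insert q Q) (insert q' Q')"
proof -
  note s = back_forth_sub[OF bf]
  note b = bf[unfolded back_forth_def]
  have sub: "Q \<union> (B \<union> H) \<subseteq> univ M" "Q' \<union> (B \<union> H) \<subseteq> univ M" using s(1,2) H_sub by auto
  have "Domain R \<subseteq> Cl M (Q \<union> (B \<union> H))" "Range R \<subseteq> Cl M (Q' \<union> (B \<union> H))"
    using b cl_mono[of "B \<union> Domain P \<union> Q", OF _ sub(1)] cl_mono[of "B \<union> Range P \<union> Q'", OF _ sub(2)]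
    by (blast, blast)
  then obtain R' where R': "insert (q, q') R \<subseteq> R'" "partial_iso L M M R'"
    "Domain R' = Cl M (insert q (Domain R))" "Range R' = Cl M (insert q' (Range R))"
    using generic_extension[of R q q'] b s(3-6) q q' by auto
  have "B \<union> Domain P \<union> insert q Q = insert q (B \<union> Domain P \<union> Q)"
    "B \<union> Range P \<union> insert q' Q' = insert q' (B \<union> Range P \<union> Q')" by auto
  then have dr: "Domain R' = Cl M (B \<union> Domain P \<union> insert q Q)"
    "Range R' = Cl M (B \<union> Range P \<union> insert q' Q')"
    using R'(3,4) b cl_insert_cl[OF s(1) q(1)] cl_insert_cl[OF s(2) q'(1)] by simp_all
  have "indep_over (Cl M) (B \<union> H) (insert q Q)" "indep_over (Cl M) (B \<union> H) (insert q' Q')"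
    using b q q' sub by (auto intro!: indep_over_insert)
  moreover have "q \<notin> Q" "q' \<notin> Q'" using q q' cl_extensive[OF sub(1)] cl_extensive[OF sub(2)] by auto
  then have "card (insert q Q) = card (insert q' Q')" using b by simp
  ultimately have "back_forth R' P (insert q Q) (insert q' Q')"
    unfolding back_forth_def using b R' dr q(1) q'(1) by simp blast
  then show ?thesis using R'(1) by auto
qed

text \<open>The partner \<open>p\<close> of \<open>d\<close> is found in the domain side itself: \<open>insert d (Domain P)\<close> is independent over \<open>B\<close> and
  larger than \<open>Range P\<close>, so one of its points is not generated by \<open>Range P\<close> over \<open>B\<close>. This point
  belongs to \<open>H\<close>, hence \<open>Q'\<close> does not generate it either.\<close>

lemma back_forth_extend_H:
  assumes bf: "back_forth R P Q Q'" and d: "d \<in> H"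
  shows "\<exists>R' P'. R \<subseteq> R' \<and> back_forth R' P' Q Q' \<and> d \<in> Domain R'"
proof (cases "d \<in> Domain R")
  case True
  then show ?thesis using bf by auto
next
  case False
  note s = back_forth_sub[OF bf]
  note b = bf[unfolded back_forth_def]
  have R: "Domain R \<subseteq> univ M" using b by (auto simp: partial_iso_def)
  have "Cl M (Domain P \<union> B) \<subseteq> Domain R"
    using cl_mono[of "Domain P \<union> B" "Domain R"] s(5,7) R by auto
  then have ind: "indep_over (Cl M) B (insert d (Domain P))"
    using False b d s(1) H_sub by (intro indep_over_insert) auto
  have "d \<notin> Domain P" using False s(7) by auto
  then have card: "card (Range P) < card (insert d (Domain P))"
    using b by (simp add: finite_Domain)
  have PH: "Domain P \<subseteq> H" "Range P \<subseteq> H" using b by auto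
  obtain p where p: "p \<in> insert d (Domain P)" "p \<notin> Cl M (Range P \<union> B)"
    by (rule augment[OF _ ind card]) (use b PH d H_sub B_sub in \<open>auto simp: finite_Range\<close>)
  have pH: "p \<in> H" using p(1) d PH by auto
  have "p \<notin> Range R"
  proof
    assume "p \<in> Range R"
    then have "p \<in> Cl M (Q' \<union> (Range P \<union> B))" using b by (simp add: ac_simps)
    then have "p \<in> Cl M (Range P \<union> B)"
      by (intro cl_drop_indep[of Q' "B \<union> H" p "Range P \<union> B"])
        (use b pH PH H_sub B_sub in auto)
    then show False using p(2) by simp
  qed
  then obtain R' where "R \<subseteq> R'" "back_forth R' (insert (d, p) P) Q Q'"
    using back_forth_insert_H[OF bf d False pH] by auto
  moreover from this have "d \<in> Domain R'" using back_forth_sub(7) by blast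
  ultimately show ?thesis by blast
qed

lemma back_forth_extend_H_finite:
  assumes "finite F" "F \<subseteq> H" and bf: "back_forth R P Q Q'"
  shows "\<exists>R' P'. R \<subseteq> R' \<and> back_forth R' P' Q Q' \<and> F \<subseteq> Domain R'"
  using assms(1,2)
proof (induction F rule: finite_induct)
  case empty
  then show ?case using bf by auto
next
  case (insert d F)
  then obtain R1 P1 where 1: "R \<subseteq> R1" "back_forth R1 P1 Q Q'" "F \<subseteq> Domain R1" by auto
  obtain R2 P2 where "R1 \<subseteq> R2" "back_forth R2 P2 Q Q'" "d \<in> Domain R2"
    using back_forth_extend_H[OF 1(2), of d] insert.prems by auto
  then show ?case using 1 by (intro exI[of _ R2] exI[of _ P2]) blast
qed

text \<open>If \<open>d\<close> depends on the current domain and \<open>H\<close>, finitely many points of \<open>H\<close> are absorbed first, after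
  which \<open>d\<close> is in the domain because domains are closed. Otherwise \<open>d\<close> joins \<open>Q\<close>, and exchange provides its
  partner from \<open>insert d Q\<close>.\<close>

lemma back_forth_extend:
  assumes bf: "back_forth R P Q Q'" and d: "d \<in> univ M"
  shows "\<exists>R' P' Q1 Q1'. R \<subseteq> R' \<and> back_forth R' P' Q1 Q1' \<and> d \<in> Domain R'"
proof (cases "d \<in> Cl M (Domain R \<union> H)")
  case True
  note s = back_forth_sub[OF bf]
  have R: "Domain R \<union> H \<subseteq> univ M" using bf H_sub by (auto simp: partial_iso_def back_forth_def)
  obtain F where F: "finite F" "F \<subseteq> Domain R \<union> H" "d \<in> Cl M F" using cl_finitary[OF R True] by auto
  obtain R' P' where R': "R \<subseteq> R'" "back_forth R' P' Q Q'" "F \<inter> H \<subseteq> Domain R'"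
    using back_forth_extend_H_finite[OF _ _ bf, of "F \<inter> H"] F(1) by auto
  have "Domain R \<subseteq> Domain R'" using R'(1) by auto
  then have "F \<subseteq> Domain R'" using F(2) R'(3) by blast
  moreover have "Domain R' \<subseteq> univ M" using R'(2) by (auto simp: partial_iso_def back_forth_def)
  ultimately have "d \<in> Cl M (Domain R')" using F(3) in_cl_mono by blast
  then have "d \<in> Domain R'" using back_forth_sub(5)[OF R'(2)] by simp
  then show ?thesis using R' by blast
next
  case False
  note s = back_forth_sub[OF bf]
  note b = bf[unfolded back_forth_def]
  have R: "Domain R \<union> H \<subseteq> univ M" using bf H_sub by (auto simp: partial_iso_def back_forth_def)
  have "Q \<union> (B \<union> H) \<subseteq> Domain R \<union> H" using s(7) by auto
  then have dQ: "d \<notin> Cl M (Q \<union> (B \<union> H))" using False cl_mono[OF _ R] by blast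
  have sub: "Q \<union> (B \<union> H) \<subseteq> univ M" using s(1) H_sub by auto
  have ind: "indep_over (Cl M) (B \<union> H) (insert d Q)"
    using dQ b d B_sub H_sub by (intro indep_over_insert) auto
  have "d \<notin> Q" using dQ cl_extensive[OF sub] by auto
  then have card: "card Q' < card (insert d Q)" using b by simp
  obtain q where q: "q \<in> insert d Q" "q \<notin> Cl M (Q' \<union> (B \<union> H))"
    by (rule augment[OF _ ind card]) (use b d H_sub B_sub in auto)
  then have "q \<in> univ M" using d b by auto
  then obtain R' where R': "R \<subseteq> R'" "back_forth R' P (insert d Q) (insert q Q')"
    using back_forth_insert_generic[OF bf d dQ _ q(2)] by auto
  then have "d \<in> Domain R'" using back_forth_sub(7) by blast
  then show ?thesis using R' by blast
qed

lemma back_forth_Id_on: "back_forth (Id_on B) {} {} {}"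
  unfolding back_forth_def using B_closed B_sub
  by (simp add: partial_iso_Id_on cl_indep_def)

lemma back_forth_extend_finite:
  assumes "finite F" "F \<subseteq> univ M"
  shows "\<exists>R P Q Q'. back_forth R P Q Q' \<and> F \<subseteq> Domain R"
  using assms
proof (induction F rule: finite_induct)
  case empty
  then show ?case using back_forth_Id_on by blast
next
  case (insert d F)
  then obtain R P Q Q' where 1: "back_forth R P Q Q'" "F \<subseteq> Domain R" by auto
  obtain R2 P2 Q2 Q2' where "R \<subseteq> R2" "back_forth R2 P2 Q2 Q2'" "d \<in> Domain R2"
    using back_forth_extend[OF 1(1), of d] insert.prems by blast
  then show ?case using 1 by (intro exI[of _ R2] exI[of _ P2] exI[of _ Q2] exI[of _ Q2']) blast
qed

lemma wf_tm_expand: "wf_tm (expand_lang L) t = wf_tm L t"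
  by (induction t) (auto simp: expand_lang_def)

lemma val_expand: "val (expand M H) e t = val M e t"
proof (induction t)
  case (App f ts)
  then have "map (val (expand M H) e) ts = map (val M e) ts" by auto
  then show ?case by (simp add: expand_def del: map_eq_conv)
qed simp

text \<open>Domains are closed and therefore substructures, so the value of a term stays in the domain of the
  relation. This matters for the predicate \<open>H\<close> applied to a compound term, which is no longer a quantifier-free
  formula of \<open>L\<close>.\<close>

lemma back_forth_val:
  assumes bf: "back_forth R P Q Q'"
  shows "\<lbrakk>wf_tm L t; \<And>i. i \<in> tvars t \<Longrightarrow> (e i, e' i) \<in> R\<rbrakk> \<Longrightarrow> (val M e t, val M e' t) \<in> R"
proof (induction t)
  case (App f ts)
  have R: "partial_iso L M M R" using bf by (simp add: back_forth_def)
  have IH: "(val M e t, val M e' t) \<in> R" if "t \<in> set ts" for t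
    using App that by auto
  let ?ps = "map (\<lambda>t. (val M e t, val M e' t)) ts"
  have ps: "set ?ps \<subseteq> R" using IH by auto
  have f: "f \<in> Funs L" "length ts = far L f" using App by auto
  have DR: "Domain R \<subseteq> univ M" using R by (auto simp: partial_iso_def)
  have "set (map (val M e) ts) \<subseteq> Domain R" using IH by auto
  moreover from this have "fun_of M f (map (val M e) ts) \<in> Cl M (set (map (val M e) ts))"
    using f DR by (intro fun_in_cl) auto
  ultimately have "fun_of M f (map (val M e) ts) \<in> Cl M (Domain R)"
    using DR in_cl_mono by blast
  then have "val M e (App f ts) \<in> Domain R" using back_forth_sub(5)[OF bf] by simp
  then obtain y where y: "(val M e (App f ts), y) \<in> R" by auto
  have "y = fun_of M f (map snd ?ps)"
    using partial_iso_fun[OF R f(1), of ?ps "val M e (App f ts)" y] f(2) ps y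
    by (simp add: comp_def)
  then show ?case using y by (simp add: comp_def)
qed simp

lemma back_forth_sat:
  fixes \<phi> :: "('f, 'r option, nat) fm"
  assumes "back_forth R P Q Q'" "wf_fm (expand_lang L) \<phi>"
    and "\<And>i. i \<in> fvars \<phi> \<Longrightarrow> (e i, e' i) \<in> R"
  shows "sat (expand M H) \<phi> e \<longleftrightarrow> sat (expand M H) \<phi> e'"
  using assms
proof (induction \<phi> arbitrary: R P Q Q' e e')
  case (Eq s t)
  have R: "partial_iso L M M R" using Eq by (simp add: back_forth_def)
  show ?case
    using partial_iso_eq_iff[OF R back_forth_val[OF Eq(1), of s e e'] back_forth_val[OF Eq(1), of t e e']]
      Eq by (simp add: wf_tm_expand val_expand)
next
  case (Rel r ts)
  have R: "partial_iso L M M R" using Rel by (simp add: back_forth_def)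
  have wf: "r \<in> Rels (expand_lang L)" "length ts = rar (expand_lang L) r"
    "\<And>t. t \<in> set ts \<Longrightarrow> wf_tm L t"
    using Rel(2) by (auto simp: wf_tm_expand)
  have v: "(val M e t, val M e' t) \<in> R" if "t \<in> set ts" for t
    using back_forth_val[OF Rel(1) wf(3)[OF that]] Rel(3) that by auto
  have ve: "map (val (expand M H) d) ts = map (val M d) ts" for d by (simp add: val_expand)
  show ?case
  proof (cases r)
    case None
    then have "length ts = 1" using wf(2) by (simp add: expand_lang_def)
    then obtain t where t: "ts = [t]" by (cases ts) auto
    show ?thesis
      using back_forth_H_iff[OF Rel(1) v[of t]] None t by (simp add: expand_def val_expand[unfolded expand_def])
  next
    case (Some r')
    let ?\<phi> = "fm.Rel r' ts :: ('f, 'r, nat) fm"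
    have "wf_fm L ?\<phi>" "qfree ?\<phi>"
      using wf Some by (auto simp: expand_lang_def)
    from partial_iso_sat[OF R this, of e e']
    have "rel_of M r' (map (val M e) ts) = rel_of M r' (map (val M e') ts)"
      using Rel(3) by auto
    then show ?thesis unfolding sat.simps ve using Some by (simp add: expand_def)
  qed
next
  case (Neg \<phi>)
  then show ?case using Neg.IH[OF Neg.prems(1), of e e'] by simp
next
  case (And \<phi> \<psi>)
  have "sat (expand M H) \<phi> e = sat (expand M H) \<phi> e'"
    by (rule And.IH(1)[OF And.prems(1)]) (use And.prems in auto)
  moreover have "sat (expand M H) \<psi> e = sat (expand M H) \<psi> e'"
    by (rule And.IH(2)[OF And.prems(1)]) (use And.prems in auto)
  ultimately show ?case by simp
next
  case (CAnd \<Phi>)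
  have "sat (expand M H) (\<Phi> n) e = sat (expand M H) (\<Phi> n) e'" for n
    by (rule CAnd.IH[OF _ CAnd.prems(1)]) (use CAnd.prems in auto)
  then show ?case by simp
next
  case (Ex x \<phi>)
  have one: "sat (expand M H) (Ex x \<phi>) d'"
    if bf: "back_forth R P Q Q'" and d: "\<And>i. i \<in> fvars (Ex x \<phi>) \<Longrightarrow> (d i, d' i) \<in> R"
      and sat: "sat (expand M H) (Ex x \<phi>) d" for R P Q Q' d d'
  proof -
    obtain a where a: "a \<in> univ M" "sat (expand M H) \<phi> (d(x := a))"
      using sat by (auto simp: expand_def)
    obtain R1 P1 Q1 Q1' where R1: "R \<subseteq> R1" "back_forth R1 P1 Q1 Q1'" "a \<in> Domain R1"
      using back_forth_extend[OF bf a(1)] by blast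
    obtain a' where a': "(a, a') \<in> R1" using R1(3) by auto
    have "sat (expand M H) \<phi> (d(x := a)) = sat (expand M H) \<phi> (d'(x := a'))"
      by (rule Ex.IH[OF R1(2)]) (use Ex.prems(2) d R1(1) a' in auto)
    moreover have "a' \<in> univ (expand M H)"
      using R1(2) a' by (auto simp: expand_def back_forth_def partial_iso_def)
    ultimately show ?thesis using a(2) by auto
  qed
  show ?case
    using one[OF Ex.prems(1), of e e'] one[OF back_forth_converse[OF Ex.prems(1)], of e' e]
      Ex.prems(3) by blast
qed

lemma back_forth_tp_H:
  assumes bf: "back_forth R P Q Q'" and as: "length as = length as'"
    "\<And>i. i < length as \<Longrightarrow> (as ! i, as' ! i) \<in> R"
  shows "tp_H L M H as B = tp_H L M H as' B"
proof -
  have "sat (expand M H) \<phi> (\<lambda>i. (as @ bs) ! i) = sat (expand M H) \<phi> (\<lambda>i. (as' @ bs) ! i)"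
    if "set bs \<subseteq> B" "wf_fm (expand_lang L) \<phi>" "fvars \<phi> \<subseteq> {..<length as + length bs}" for \<phi> bs
  proof (rule back_forth_sat[OF bf that(2)])
    fix i assume "i \<in> fvars \<phi>"
    then have i: "i < length as + length bs" using that(3) by auto
    have "Id_on B \<subseteq> R" using bf by (simp add: back_forth_def)
    moreover have "bs ! (i - length as) \<in> B" if "\<not> i < length as"
      using i that \<open>set bs \<subseteq> B\<close> by (auto simp: subset_iff)
    ultimately show "((as @ bs) ! i, (as' @ bs) ! i) \<in> R"
      using as by (auto simp: nth_append)
  qed
  then show ?thesis using as(1) unfolding tp_H_def by auto
qed

section \<open>Counting types\<close>

lemma back_forth_exists_H:
  assumes "finite P" "P \<subseteq> H" "indep_over (Cl M) B P"
    and "finite P'" "P' \<subseteq> H" "indep_over (Cl M) B P'" "card P = card P'"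
  shows "\<exists>R S. back_forth R S {} {} \<and> Domain S = P \<and> Range S = P'"
  using assms
proof (induction P arbitrary: P' rule: finite_induct)
  case empty
  then show ?case using back_forth_Id_on by auto
next
  case (insert p P)
  then obtain p' where p': "p' \<in> P'" by fastforce
  let ?P' = "P' - {p'}"
  have sub: "insert p P \<subseteq> univ M" "P' \<subseteq> univ M" using insert.prems H_sub by auto
  have "\<exists>R S. back_forth R S {} {} \<and> Domain S = P \<and> Range S = ?P'"
  proof (rule insert.IH)
    show "indep_over (Cl M) B P" "indep_over (Cl M) B ?P'"
      using indep_over_subset[OF insert.prems(2), of P] indep_over_subset[OF insert.prems(5), of ?P']
        sub B_sub by auto
    show "card P = card ?P'" using insert p' by simp
  qed (use insert.prems in auto)
  then obtain R S where RS: "back_forth R S {} {}" "Domain S = P" "Range S = ?P'" by auto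
  have "insert p P - {p} \<union> B = B \<union> P \<union> {}" "P' - {p'} \<union> B = B \<union> ?P' \<union> {}"
    using insert.hyps by auto
  moreover have "p \<notin> Cl M (insert p P - {p} \<union> B)" "p' \<notin> Cl M (P' - {p'} \<union> B)"
    using insert.prems(2,5) p' by (auto simp: indep_over_iff)
  moreover have "Domain R = Cl M (B \<union> P \<union> {})" "Range R = Cl M (B \<union> ?P' \<union> {})"
    using RS by (simp_all add: back_forth_def)
  ultimately have "p \<notin> Domain R" "p' \<notin> Range R" by simp_all
  then obtain R' where "back_forth R' (insert (p, p') S) {} {}"
    using back_forth_insert_H[OF RS(1), of p p'] insert.prems p' by auto
  moreover have "Domain (insert (p, p') S) = insert p P" "Range (insert (p, p') S) = P'"
    using RS p' by auto
  ultimately show ?case by blast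
qed

lemma back_forth_exists:
  assumes P: "finite P" "P \<subseteq> H" "indep_over (Cl M) B P"
    "finite P'" "P' \<subseteq> H" "indep_over (Cl M) B P'" "card P = card P'"
    and Q: "finite Q" "Q \<subseteq> univ M" "indep_over (Cl M) (B \<union> H) Q"
      "finite Q'" "Q' \<subseteq> univ M" "indep_over (Cl M) (B \<union> H) Q'" "card Q = card Q'"
  shows "\<exists>R S. back_forth R S Q Q' \<and> Domain S = P \<and> Range S = P'"
  using Q
proof (induction Q arbitrary: Q' rule: finite_induct)
  case empty
  then show ?case using back_forth_exists_H[OF P] by auto
next
  case (insert q Q)
  then obtain q' where q': "q' \<in> Q'" by fastforce
  let ?Q' = "Q' - {q'}"
  have BH: "B \<union> H \<subseteq> univ M" using B_sub H_sub by auto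
  have "\<exists>R S. back_forth R S Q ?Q' \<and> Domain S = P \<and> Range S = P'"
  proof (rule insert.IH)
    show "indep_over (Cl M) (B \<union> H) Q" "indep_over (Cl M) (B \<union> H) ?Q'"
      using indep_over_subset[OF insert.prems(2), of Q] indep_over_subset[OF insert.prems(5), of ?Q']
        insert.prems BH by auto
    show "card Q = card ?Q'" using insert q' by simp
  qed (use insert.prems in auto)
  then obtain R S where RS: "back_forth R S Q ?Q'" "Domain S = P" "Range S = P'" by auto
  have "insert q Q - {q} = Q" using insert.hyps by auto
  moreover have "q \<notin> Cl M (insert q Q - {q} \<union> (B \<union> H))" "q' \<notin> Cl M (?Q' \<union> (B \<union> H))"
    using insert.prems(2,5) q' by (auto simp: indep_over_iff)
  ultimately obtain R' where "back_forth R' S (insert q Q) (insert q' ?Q')"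
    using back_forth_insert_generic[OF RS(1), of q q'] insert.prems q' by auto
  moreover have "insert q' ?Q' = Q'" using q' by auto
  ultimately show ?case using RS by auto
qed

definition generic_pair :: "nat \<Rightarrow> nat \<Rightarrow> 'a set \<Rightarrow> 'a set \<Rightarrow> bool" where
  "generic_pair m n P Q \<longleftrightarrow>
     finite P \<and> P \<subseteq> H \<and> indep_over (Cl M) B P \<and> card P = m \<and>
     finite Q \<and> Q \<subseteq> univ M \<and> indep_over (Cl M) (B \<union> H) Q \<and> card Q = n"

text \<open>Fix one pair \<open>(P0, Q0)\<close> with cardinalities \<open>m\<close>, \<open>n\<close>. Any other pair is matched with it by the back-and-forth
  system, which carries the tuple \<open>as\<close> into the countable set \<open>cl (B \<union> P0 \<union> Q0)\<close> without changing its type.\<close>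

lemma countable_types_generic:
  "countable {tp_H L M H as B |as P Q. generic_pair m n P Q \<and> set as \<subseteq> Cl M (B \<union> P \<union> Q)}"
    (is "countable ?T")
proof (cases "\<exists>P Q. generic_pair m n P Q")
  case True
  then obtain P0 Q0 where 0: "generic_pair m n P0 Q0" by auto
  let ?C = "Cl M (B \<union> P0 \<union> Q0)"
  have "countable (B \<union> P0 \<union> Q0)" "B \<union> P0 \<union> Q0 \<subseteq> univ M"
    using 0 B_countable B_sub H_sub by (auto simp: generic_pair_def intro: countable_finite)
  then have "countable ?C" by (rule countable_cl_countable)
  have "?T \<subseteq> (\<lambda>as. tp_H L M H as B) ` lists ?C"
  proof
    fix t assume "t \<in> ?T"
    then obtain as P Q where t: "t = tp_H L M H as B" "generic_pair m n P Q"
      and as: "set as \<subseteq> Cl M (B \<union> P \<union> Q)" by auto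
    obtain R S where R: "back_forth R S Q Q0" "Domain S = P" "Range S = P0"
      using back_forth_exists[of P P0 Q Q0] t(2) 0 by (auto simp: generic_pair_def)
    then have dr: "Domain R = Cl M (B \<union> P \<union> Q)" "Range R = ?C" by (auto simp: back_forth_def)
    define g where "g a = (SOME a'. (a, a') \<in> R)" for a
    have g: "(a, g a) \<in> R" if "a \<in> set as" for a
      using that as dr(1) unfolding g_def by (metis DomainE someI subsetD)
    have "t = tp_H L M H (map g as) B"
      unfolding t(1) by (rule back_forth_tp_H[OF R(1)]) (use g in auto)
    moreover have "g a \<in> ?C" if "a \<in> set as" for a
      unfolding dr(2)[symmetric] using g[OF that] by (rule RangeI)
    then have "map g as \<in> lists ?C" by auto
    ultimately show "t \<in> (\<lambda>as. tp_H L M H as B) ` lists ?C" by blast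
  qed
  then show ?thesis using \<open>countable ?C\<close> by (meson countable_image countable_lists countable_subset)
qed auto

theorem countable_types: "countable {tp_H L M H as B |as. set as \<subseteq> univ M}"
proof (rule countable_subset)
  let ?T = "\<lambda>(m, n). {tp_H L M H as B |as P Q. generic_pair m n P Q \<and> set as \<subseteq> Cl M (B \<union> P \<union> Q)}"
  show "countable (\<Union>mn. ?T mn)"
    using countable_types_generic by (intro countable_UN) (simp_all add: split_paired_all)
  show "{tp_H L M H as B |as. set as \<subseteq> univ M} \<subseteq> (\<Union>mn. ?T mn)"
  proof
    fix t assume "t \<in> {tp_H L M H as B |as. set as \<subseteq> univ M}"
    then obtain as where t: "t = tp_H L M H as B" "set as \<subseteq> univ M" by auto
    obtain R P Q Q' where R: "back_forth R P Q Q'" "set as \<subseteq> Domain R"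
      using back_forth_extend_finite[OF _ t(2)] by auto
    then have "generic_pair (card (Domain P)) (card Q) (Domain P) Q"
      unfolding generic_pair_def back_forth_def by (auto simp: finite_Domain)
    moreover have "set as \<subseteq> Cl M (B \<union> Domain P \<union> Q)" using R by (simp add: back_forth_def)
    ultimately have "t \<in> ?T (card (Domain P), card Q)" using t(1) by auto
    then show "t \<in> (\<Union>mn. ?T mn)" by blast
  qed
qed

end

theorem proposition4p23:
  fixes L :: "('f, 'r) lang"
    and \<C> :: "('f, 'r, 'a) pgstruc set"
    and M :: "('f, 'r, 'a) pgstruc"
    and H B :: "'a set"
  assumes "quasiminimal_class L \<C>"
    and "H_structure \<C> M H \<or> beautiful_pair L \<C> M H"
    and "B \<subseteq> univ M"
    and "Cl M B = B"
    and "H_independent M H B"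
    and "countable B"
  shows "countable {tp_H L M H as B |as. set as \<subseteq> univ M}"
proof -
  obtain M0 where M0: "quasiminimal L M0" "\<C> = generated_class L M0"
    using assms(1) by (auto simp: quasiminimal_class_def)
  have M: "M \<in> \<C>" "H \<subseteq> univ M"
    using assms(2) by (auto simp: H_structure_def beautiful_pair_def dense_codense_def)
  interpret generic_homogeneous L M
    using generated_class_generic_homogeneous[OF M0(1)] M M0(2) by simp
  have "(\<forall>F. finite F \<and> F \<subseteq> H \<longrightarrow> cl_indep (Cl M) F) \<or> Cl M H = H"
    using assms(2)
  proof
    assume "beautiful_pair L \<C> M H"
    then obtain N where N: "N \<in> \<C>" "univ N = H" "closed_sub L N M"
      by (auto simp: beautiful_pair_def)
    interpret N: generic_homogeneous L N
      using generated_class_generic_homogeneous[OF M0(1)] N M0(2) by simp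
    have "Cl M H = Cl N H" using closed_sub_Cl[OF N(3), of H] N(2) by simp
    also have "\<dots> \<subseteq> H" using N.cl_subset[of H] N(2) by simp
    finally show ?thesis using cl_extensive[OF M(2)] by auto
  qed (auto simp: H_structure_def)
  then interpret expansion_over L M H B
    using M assms(3-6) by unfold_locales
  show ?thesis by (rule countable_types)
qed

end
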